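(* Let $A, B$ be unital C*-algebras, $n$ a positive integer, and $P:A\to B$ an orthogonally additive $n$-homogeneous polynomial. Suppose that $h:=P(1)$ is a unitary in $B$, that $B=\operatorname{span} P(A)$ (the linear span of the range of $P$), and that $\|P(x)\| = \|x\|^n$ for every normal element $x$ in $A$. Then there is a Jordan $*$-isomorphism $J:A\to B$ such that $$ P(a) = hJ(a)^n, \quad\forall a\in A. $$
   Context: An $n$-homogeneous polynomial $P:E\to F$ is a map $P(x)=L(x,\dots,x)$ with $L:E\times\cdots\times E\to F$ a symmetric $n$-linear operator. $P$ is orthogonally additive if $ab=ba=0$ implies $P(a+b)=P(a)+P(b)$ for all $a,b\in A$. A Jordan $*$-isomorphism is a bijective complex-linear map $J$ with $J(a^2)=J(a)^2$ and $J(a^* )=J(a)^*$ for all $a$. *)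

theory Defs
  imports "HOL-Analysis.Analysis" "HOL-Combinatorics.Permutations"
begin

class complex_vector = real_vector +
  fixes scaleC :: "complex \<Rightarrow> 'a \<Rightarrow> 'a"  (infixr "*\<^sub>C" 75)
  assumes scaleC_add_right: "c *\<^sub>C (x + y) = c *\<^sub>C x + c *\<^sub>C y"
    and scaleC_add_left: "(c + d) *\<^sub>C x = c *\<^sub>C x + d *\<^sub>C x"
    and scaleC_scaleC: "c *\<^sub>C d *\<^sub>C x = (c * d) *\<^sub>C x"
    and scaleR_scaleC: "r *\<^sub>R x = complex_of_real r *\<^sub>C x"

lemma scaleC_one [simp]: "1 *\<^sub>C x = (x :: 'a::complex_vector)"
  using scaleR_scaleC [of 1 x] by simp

global_interpretation complex_vector:
  vector_space "scaleC :: complex \<Rightarrow> 'a \<Rightarrow> 'a::complex_vector"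
  by unfold_locales (simp_all add: scaleC_add_right scaleC_add_left scaleC_scaleC)

abbreviation clinear :: "('a::complex_vector \<Rightarrow> 'b::complex_vector) \<Rightarrow> bool"
  where "clinear \<equiv> Vector_Spaces.linear scaleC scaleC"

text \<open>
  Completeness comes from \<^class>\<open>banach\<close>. The class \<^class>\<open>real_normed_algebra_1\<close> contributes
  submultiplicativity of the norm, and the convention that a unital algebra satisfies \<open>1 \<noteq> 0\<close>
  and \<open>norm 1 = 1\<close>; the latter would follow from \<open>1 \<noteq> 0\<close> and the C*-identity.
\<close>

class unital_cstar_algebra = complex_vector + real_normed_algebra_1 + banach +
  fixes star :: "'a \<Rightarrow> 'a"
  assumes mult_scaleC_left: "(c *\<^sub>C x) * y = c *\<^sub>C (x * y)"
    and mult_scaleC_right: "x * (c *\<^sub>C y) = c *\<^sub>C (x * y)"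
    and norm_scaleC: "norm (c *\<^sub>C x) = cmod c * norm x"
    and star_star: "star (star x) = x"
    and star_add: "star (x + y) = star x + star y"
    and star_scaleC: "star (c *\<^sub>C x) = cnj c *\<^sub>C star x"
    and star_mult: "star (x * y) = star y * star x"
    and cstar_identity: "norm (star x * x) = (norm x)\<^sup>2"

definition unitary :: "'a::unital_cstar_algebra \<Rightarrow> bool"
  where "unitary u \<longleftrightarrow> star u * u = 1 \<and> u * star u = 1"

definition normal_element :: "'a::unital_cstar_algebra \<Rightarrow> bool"
  where "normal_element x \<longleftrightarrow> star x * x = x * star x"

text \<open>
  A map \<open>E \<times> \<dots> \<times> E \<rightarrow> F\<close> of \<open>n\<close> variables is represented by a function on lists; only its values
  on lists of length \<open>n\<close> matter.
\<close>

definition multilinear :: "nat \<Rightarrow> ('a::complex_vector list \<Rightarrow> 'b::complex_vector) \<Rightarrow> bool"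
  where "multilinear n L \<longleftrightarrow>
    (\<forall>xs i. length xs = n \<longrightarrow> i < n \<longrightarrow> clinear (\<lambda>y. L (xs[i := y])))"

definition symmetric_map :: "nat \<Rightarrow> ('a list \<Rightarrow> 'b) \<Rightarrow> bool"
  where "symmetric_map n L \<longleftrightarrow>
    (\<forall>xs p. length xs = n \<longrightarrow> p permutes {..<n} \<longrightarrow> L (permute_list p xs) = L xs)"

definition homogeneous_polynomial ::
    "nat \<Rightarrow> ('a::complex_vector \<Rightarrow> 'b::complex_vector) \<Rightarrow> bool"
  where "homogeneous_polynomial n P \<longleftrightarrow>
    (\<exists>L. multilinear n L \<and> symmetric_map n L \<and> (\<forall>x. P x = L (replicate n x)))"

definition orthogonally_additive ::
    "('a::unital_cstar_algebra \<Rightarrow> 'b::unital_cstar_algebra) \<Rightarrow> bool"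
  where "orthogonally_additive P \<longleftrightarrow>
    (\<forall>a b. a * b = 0 \<and> b * a = 0 \<longrightarrow> P (a + b) = P a + P b)"

definition jordan_star_isomorphism ::
    "('a::unital_cstar_algebra \<Rightarrow> 'b::unital_cstar_algebra) \<Rightarrow> bool"
  where "jordan_star_isomorphism J \<longleftrightarrow>
    bij J \<and> clinear J \<and> (\<forall>a. J (a\<^sup>2) = (J a)\<^sup>2) \<and> (\<forall>a. J (star a) = star (J a))"

end

(*
  Let L be the symmetric n-linear map of P and T(a) = L(a, 1, ..., 1). Inside the commutative algebra
  generated by a self-adjoint x, orthogonal additivity makes L local: it vanishes as soon as two of
  its arguments are orthogonal. Replacing x by staircase functions then yields
  L(x f, g, ...) = L(f, x g, ...), hence P(x) = T(x^n) for self-adjoint x, and for all x by comparing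
  the coefficients of the polynomial t |-> P(x + t y).

  S = h^* T is unital and surjective. Self-adjoint elements are n-th powers of normal ones, so S is
  isometric on them, and the elements 1 + i t x / n show that S preserves self-adjointness. Thus S and
  its inverse are positive, Kadison's inequality applies to both, and S(x^2) = S(x)^2.

  No spectral theory is used. The functional calculus rests on the fact that a self-adjoint
  contraction is the real part of a unitary.
*)
theory Submission
  imports Defs "HOL-Computational_Algebra.Polynomial" "HOL-Library.Multiset"
begin

text \<open>No continuity of \<open>P\<close> is assumed. Every estimate on \<open>L\<close> is
  extracted from the norm hypothesis by polarization, and these estimates are what allows
  \<open>x\<close> to be replaced by staircase functions up to a small error. The functional
  calculus lives on the whole interval from \<open>- norm x\<close> to \<open>norm x\<close> and not
  on the spectrum, so it may have a kernel: elements can be orthogonal although the functions behind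
  them are not. Locality is therefore proved with cut-offs inside the algebra.

  Without a spectrum, sharp estimates are obtained by first allowing a factor linear in the exponent
  and then removing it along the powers \<open>2 ^ k\<close>, whose norms the C*-identity computes
  exactly.

  The norm of \<open>S\<close> is known only on \<open>n\<close>-th powers of normal elements. For
  even \<open>n\<close> a self-adjoint element may have no self-adjoint root, hence the normal ones.
  Kadison's inequality needs \<open>c * p * c\<close> to be positive for positive \<open>p\<close>;
  with positivity defined by a norm inequality this is the hard part, and it rests on the positivity
  of \<open>star y * y\<close>.\<close>

lemma scaleC_minus1: "(-1) *\<^sub>C x = - (x::'a::complex_vector)"
  using scaleR_scaleC[of "-1" x] by simp

lemma scaleC_scaleR: "c *\<^sub>C r *\<^sub>R x = r *\<^sub>R c *\<^sub>C (x::'a::complex_vector)"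
  by (simp only: scaleR_scaleC scaleC_scaleC mult.commute)

lemma clinear_add: "clinear f \<Longrightarrow> f (x + y) = f x + f y"
  and clinear_scaleC: "clinear f \<Longrightarrow> f (c *\<^sub>C x) = c *\<^sub>C f x"
  by (simp_all add: Vector_Spaces.linear_iff)

lemma clinear_imp_linear: "clinear f \<Longrightarrow> linear f"
  by (intro linearI) (simp_all add: clinear_add clinear_scaleC scaleR_scaleC)

lemma clinearI:
  fixes f :: "'a::complex_vector \<Rightarrow> 'b::complex_vector"
  assumes "\<And>x y. f (x + y) = f x + f y" "\<And>c x. f (c *\<^sub>C x) = c *\<^sub>C f x"
  shows "clinear f"
  using assms by (simp add: Vector_Spaces.linear_iff complex_vector.vector_space_axioms)

section \<open>Involution and norm in a C*-algebra\<close>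

lemma star_zero [simp]: "star (0::'a::unital_cstar_algebra) = 0"
  using star_add[of "0::'a" 0] by simp

lemma star_minus: "star (- x) = - star (x::'a::unital_cstar_algebra)"
  using star_add[of x "-x"] by (simp add: eq_neg_iff_add_eq_0 add.commute)

lemma star_diff: "star (x - y) = star x - star (y::'a::unital_cstar_algebra)"
  using star_add[of x "-y"] by (simp add: star_minus)

lemma star_one [simp]: "star (1::'a::unital_cstar_algebra) = 1"
  using star_mult[of "star 1::'a" 1] by (simp add: star_star)

lemma star_scaleR: "star (r *\<^sub>R x) = r *\<^sub>R star (x::'a::unital_cstar_algebra)"
  by (simp add: scaleR_scaleC star_scaleC)

lemma star_power: "star (x ^ n) = star (x::'a::unital_cstar_algebra) ^ n"
  by (induction n) (simp_all add: star_mult power_commutes)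

lemma star_sum: "star (sum f A) = (\<Sum>i\<in>A. star (f i :: 'a::unital_cstar_algebra))"
  by (induction A rule: infinite_finite_induct) (simp_all add: star_add)

lemma norm_star [simp]: "norm (star x) = norm (x::'a::unital_cstar_algebra)"
proof -
  have *: "norm y \<le> norm (star y)" for y :: 'a
  proof (cases "y = 0")
    case False
    have "norm y * norm y \<le> norm (star y) * norm y"
      using cstar_identity[of y] norm_mult_ineq[of "star y" y] by (simp add: power2_eq_square)
    with False show ?thesis by simp
  qed simp
  show ?thesis using *[of x] *[of "star x"] by (simp add: star_star)
qed

lemma bounded_linear_star: "bounded_linear (star :: 'a::unital_cstar_algebra \<Rightarrow> 'a)"
  by (rule bounded_linear_intro[where K=1]) (simp_all add: star_add star_scaleR)

lemma cartesian_decomposition: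
  fixes a :: "'a::unital_cstar_algebra"
  obtains x y where "star x = x" "star y = y" "a = x + \<i> *\<^sub>C y" "norm x \<le> norm a" "norm y \<le> norm a"
proof (rule that)
  define x where "x = (1/2) *\<^sub>R (a + star a)"
  define y where "y = - (\<i> *\<^sub>C ((1/2) *\<^sub>R (a - star a)))"
  show "star x = x" by (simp add: x_def star_scaleR star_add star_star add.commute)
  have "star y = \<i> *\<^sub>C ((1/2) *\<^sub>R (star a - a))"
    by (simp add: y_def star_minus star_scaleC star_scaleR star_diff star_star)
  also have "star a - a = - (a - star a)" by simp
  finally show "star y = y" unfolding y_def by (simp only: scaleR_minus_right complex_vector.scale_minus_right)
  have "\<i> *\<^sub>C y = (1/2) *\<^sub>R (a - star a)"
    by (simp add: y_def complex_vector.scale_minus_right scaleC_scaleC)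
  then have "x + \<i> *\<^sub>C y = (1/2) *\<^sub>R (a + a)"
    by (simp add: x_def flip: scaleR_add_right)
  then show "a = x + \<i> *\<^sub>C y" by (simp add: scaleR_2[symmetric])
  show "norm x \<le> norm a" using norm_triangle_ineq[of a "star a"] by (simp add: x_def)
  show "norm y \<le> norm a" using norm_triangle_ineq4[of a "star a"] by (simp add: y_def norm_scaleC)
qed

lemma norm_power_2_power:
  fixes x :: "'a::unital_cstar_algebra"
  assumes "star x = x"
  shows "norm (x ^ (2 ^ k)) = norm x ^ (2 ^ k)"
proof (induction k)
  case (Suc k)
  have "norm (x ^ 2 ^ Suc k) = norm (star (x ^ 2 ^ k) * x ^ 2 ^ k)"
    by (simp add: star_power assms mult_2 power_add)
  also have "\<dots> = norm x ^ 2 ^ Suc k"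
    by (simp add: cstar_identity Suc mult_2 power_add power2_eq_square)
  finally show ?case .
qed simp

text \<open>This replaces the spectral radius formula: after division by \<open>b ^ (2 ^ k)\<close>,
  a ratio greater than 1 would grow exponentially in \<open>2 ^ k\<close>, while the right side
  grows only linearly.\<close>

lemma le_of_power_le_linear:
  fixes a b C D :: real
  assumes "\<And>k. a ^ (2 ^ k) \<le> (C * 2 ^ k + D) * b ^ (2 ^ k)" and "0 \<le> b"
  shows "a \<le> b"
proof (rule ccontr)
  assume "\<not> a \<le> b"
  then have ab: "b < a" by simp
  show False
  proof (cases "b = 0")
    case True
    then show False using assms(1)[of 0] ab by simp
  next
    case False
    then have b: "b > 0" using assms by simp
    define r where "r = a / b"
    have r: "r > 1" using ab b by (simp add: r_def)
    have le: "r ^ (2 ^ k) \<le> C * real (2 ^ k) + D" for k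
      using assms(1)[of k] b by (simp add: r_def power_divide divide_simps)
    have "(\<lambda>m. real m / r ^ m) \<longlonglongrightarrow> 0"
    proof -
      have "(\<lambda>m. of_nat m * (1/r) ^ m) \<longlonglongrightarrow> 0"
        by (rule powser_times_n_limit_0) (use r in auto)
      then show ?thesis by (simp add: power_divide)
    qed
    moreover have "(\<lambda>m. 1 / r ^ m) \<longlonglongrightarrow> 0"
      using LIMSEQ_inverse_realpow_zero[OF r] by (simp add: inverse_eq_divide)
    ultimately have "(\<lambda>m. C * (real m / r ^ m) + D * (1 / r ^ m)) \<longlonglongrightarrow> C * 0 + D * 0"
      by (intro tendsto_intros)
    then have "(\<lambda>m. (C * real m + D) / r ^ m) \<longlonglongrightarrow> 0"
      by (simp add: add_divide_distrib)
    then have "(\<lambda>k. (C * real (2^k) + D) / r ^ (2^k)) \<longlonglongrightarrow> 0"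
      using LIMSEQ_subseq_LIMSEQ[of "\<lambda>m. (C * real m + D) / r ^ m" 0 "\<lambda>k. 2^k :: nat"]
      by (simp add: strict_mono_def o_def)
    moreover have "1 \<le> (C * real (2^k) + D) / r ^ (2^k)" for k
      using le[of k] r by (simp add: divide_simps)
    ultimately have "1 \<le> (0::real)"
      by (meson LIMSEQ_le_const)
    then show False by simp
  qed
qed

section \<open>Real polynomials evaluated in an algebra\<close>

text \<open>The type is any real algebra because one polynomial is evaluated both at elements of the
  C*-algebra and on the complex unit circle. Real coefficients keep the values at self-adjoint
  elements self-adjoint.\<close>

definition peval :: "real poly \<Rightarrow> 'a::real_algebra_1 \<Rightarrow> 'a"
  where "peval p a = (\<Sum>i\<le>degree p. coeff p i *\<^sub>R a ^ i)"

lemma peval_altdef: "degree p \<le> N \<Longrightarrow> peval p a = (\<Sum>i\<le>N. coeff p i *\<^sub>R a ^ i)"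
  unfolding peval_def by (rule sum.mono_neutral_left) (auto simp: coeff_eq_0)

lemma peval_0 [simp]: "peval 0 a = 0"
  by (simp add: peval_def)

lemma peval_pCons [simp]: "peval (pCons c p) a = c *\<^sub>R 1 + a * peval p a"
proof -
  have "peval (pCons c p) a = (\<Sum>i\<le>Suc (degree p). coeff (pCons c p) i *\<^sub>R a ^ i)"
    by (rule peval_altdef) (simp add: degree_pCons_le)
  also have "\<dots> = c *\<^sub>R 1 + (\<Sum>i\<le>degree p. coeff p i *\<^sub>R (a * a ^ i))"
    by (subst sum.atMost_Suc_shift) simp
  finally show ?thesis by (simp add: peval_def sum_distrib_left)
qed

lemma peval_add: "peval (p + q) a = peval p a + peval q a"
proof -
  define N where "N = max (degree p) (degree q)"
  have "degree (p + q) \<le> N" "degree p \<le> N" "degree q \<le> N"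
    by (auto simp: N_def degree_add_le_max)
  then show ?thesis by (simp add: peval_altdef scaleR_add_left sum.distrib)
qed

lemma peval_smult: "peval (smult c p) a = c *\<^sub>R peval p a"
proof -
  have "degree (smult c p) \<le> degree p" by simp
  from peval_altdef[OF this] show ?thesis by (simp add: peval_def scaleR_sum_right)
qed

lemma peval_diff: "peval (p - q) a = peval p a - peval q a"
proof -
  have "p - q = p + smult (-1) q" by simp
  then show ?thesis by (simp only: peval_add peval_smult) simp
qed

lemma peval_mult: "peval (p * q) a = peval p a * peval q a"
  by (induction p) (simp_all add: peval_add peval_smult distrib_right mult.assoc)

lemma peval_1 [simp]: "peval 1 a = 1"
  by (simp add: one_pCons)

lemma peval_power: "peval (p ^ k) a = peval p a ^ k"
  by (induction k) (simp_all add: peval_mult)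

lemma peval_sum: "peval (sum f A) a = (\<Sum>i\<in>A. peval (f i) a)"
  by (induction A rule: infinite_finite_induct) (simp_all add: peval_add)

lemma peval_of_real: "peval p (of_real t :: 'a::real_algebra_1) = of_real (poly p t)"
  by (induction p) (simp_all add: scaleR_conv_of_real)

lemma star_peval: "star x = x \<Longrightarrow> star (peval p x) = peval p (x::'a::unital_cstar_algebra)"
  by (simp add: peval_def star_sum star_scaleR star_power)

lemma continuous_peval: "continuous_on UNIV (peval p :: 'a::real_normed_algebra_1 \<Rightarrow> 'a)"
  unfolding peval_def by (intro continuous_intros)

section \<open>Self-adjoint contractions as real parts of unitaries\<close>

text \<open>The binomial series of \<open>sqrt (1 + z)\<close> converges absolutely at
  \<open>z = - (x * x)\<close>. By Vandermonde's identity its Cauchy square collapses to the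
  binomial series with exponent 1, that is, to \<open>1 + z\<close>.\<close>

lemma selfadjoint_sqrt_exists:
  fixes x :: "'a::unital_cstar_algebra"
  assumes sa: "star x = x" and nx: "norm x < 1"
  obtains s where "star s = s" "s * s = 1 - x * x" "s * x = x * s"
proof -
  define c :: "nat \<Rightarrow> real" where "c k = ((1/2) gchoose k)" for k
  define z where "z = - (x * x)"
  have nz: "norm z < 1"
  proof -
    have "norm z \<le> norm x * norm x" by (simp add: z_def norm_mult_ineq)
    also have "\<dots> < 1 * 1" using nx by (intro mult_strict_mono') auto
    finally show ?thesis by simp
  qed
  define f where "f k = c k *\<^sub>R z ^ k" for k
  have summ: "summable (\<lambda>k. norm (f k))"
  proof -
    \<comment> \<open>Convergence of the real series at a radius strictly beyond
      \<open>norm z\<close> yields absolute convergence at \<open>norm z\<close>.\<close>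
    obtain r where r: "norm z < r" "r < 1" using nz dense by blast
    then have r0: "0 < r" by (meson norm_ge_zero order.strict_trans1)
    have "summable (\<lambda>k. c k * r ^ k)"
      unfolding c_def using gen_binomial_real[of r "1/2"] r r0 by (auto simp: sums_iff)
    then have "summable (\<lambda>k. norm (c k * norm z ^ k))"
      by (rule powser_insidea) (use r r0 in auto)
    then show ?thesis
      by (rule summable_comparison_test') (auto simp: f_def abs_mult intro!: mult_left_mono norm_power_ineq)
  qed
  then have sf: "summable f" by (rule summable_norm_cancel)
  define s where "s = suminf f"
  have fs: "f sums s" using sf by (simp add: s_def summable_sums)
  have zx: "z ^ k * x = x * z ^ k" for k
    by (rule power_commuting_commutes) (simp add: z_def mult.assoc)
  have "star s = s"
  proof -
    have "(\<lambda>k. star (f k)) sums star s"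
      using bounded_linear.sums[OF bounded_linear_star fs] .
    moreover have "star (f k) = f k" for k
      by (simp add: f_def star_scaleR star_power z_def star_minus star_mult sa)
    ultimately show ?thesis using fs sums_unique2 by auto
  qed
  moreover have "s * x = x * s"
    using sums_mult2[OF fs, of x] sums_mult[OF fs, of x] by (simp add: f_def zx sums_unique2)
  moreover have "s * s = 1 - x * x"
  proof -
    have "(\<lambda>k. \<Sum>i\<le>k. f i * f (k - i)) sums (s * s)"
      unfolding s_def by (rule Cauchy_product_sums[OF summ summ])
    moreover have "(\<Sum>i\<le>k. f i * f (k - i)) = (if k = 0 then 1 else if k = 1 then z else 0)" for k
    proof -
      have "(\<Sum>i\<le>k. f i * f (k - i)) = (\<Sum>i\<le>k. c i * c (k - i)) *\<^sub>R z ^ k"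
        by (simp add: f_def power_add[symmetric] scaleR_sum_left mult.commute)
      also have "(\<Sum>i\<le>k. c i * c (k - i)) = ((1::real) gchoose k)"
        using gbinomial_Vandermonde[of "1/2::real" "1/2" k] by (simp add: c_def atLeast0AtMost)
      also have "((1::real) gchoose k) = (if k \<le> 1 then 1 else 0)"
        using binomial_gbinomial[of 1 k, where 'a=real] 
        by (cases "k = 0"; cases "k = 1") (auto simp: binomial_eq_0)
      finally show ?thesis by (cases "k = 0"; cases "k = 1") auto
    qed
    ultimately have "(\<lambda>k. if k = 0 then 1 else if k = 1 then z else 0) sums (s * s)" by simp
    moreover have "(\<lambda>k. if k = 0 then 1 else if k = 1 then z else 0) sums (1 + z)"
      using sums_finite[of "{0,1::nat}" "\<lambda>k. if k = 0 then 1 else if k = 1 then z else 0"] by auto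
    ultimately show ?thesis by (simp add: sums_unique2 z_def)
  qed
  ultimately show thesis using that by blast
qed

lemma selfadjoint_unitary_exists:
  fixes x :: "'a::unital_cstar_algebra"
  assumes sa: "star x = x" and nx: "norm x < 1"
  obtains u where "star u * u = 1" "u * star u = 1" "x = (1/2) *\<^sub>R (u + star u)"
proof -
  obtain s where s: "star s = s" "s * s = 1 - x * x" "s * x = x * s"
    using selfadjoint_sqrt_exists[OF assms] .
  define u where "u = x + \<i> *\<^sub>C s"
  have su: "star u = x - \<i> *\<^sub>C s"
    by (simp add: u_def star_add star_scaleC sa s(1) complex_vector.scale_minus_left)
  show thesis
  proof (rule that[of u])
    show "star u * u = 1" "u * star u = 1"
      unfolding su unfolding u_def
      by (simp_all add: algebra_simps mult_scaleC_left mult_scaleC_right scaleC_scaleC s scaleC_minus1)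
    show "x = (1/2) *\<^sub>R (u + star u)"
      unfolding su unfolding u_def by (simp add: scaleR_2[symmetric])
  qed
qed

section \<open>Norm bounds for polynomials in a self-adjoint element\<close>

lemma sum_roots_of_unity:
  fixes N :: nat and l :: int
  assumes N: "N > 0" and l: "\<bar>l\<bar> < int N"
  shows "(\<Sum>j<N. cis (2 * pi * of_int l / N) ^ j) = (if l = 0 then of_nat N else 0)"
proof (cases "l = 0")
  case False
  define w where "w = cis (2 * pi * of_int l / N)"
  have "w \<noteq> 1"
  proof
    assume "w = 1"
    then have "cos (2 * pi * of_int l / N) = 1" by (simp add: w_def complex_eq_iff)
    then obtain k :: int where "2 * pi * of_int l / N = of_int k * 2 * pi"
      using cos_one_2pi_int by blast
    then have "real_of_int l = of_int (k * int N)" using N by (simp add: field_simps)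
    then have "l = k * int N" by (simp only: of_int_eq_iff)
    moreover from this False have "\<bar>k\<bar> \<ge> 1" by auto
    ultimately have "\<bar>l\<bar> \<ge> 1 * int N" unfolding \<open>l = k * int N\<close> abs_mult by (intro mult_mono) auto
    then show False using l by simp
  qed
  moreover have "w ^ N = 1"
  proof -
    have "w ^ N = cis (real N * (2 * pi * of_int l / N))" unfolding w_def by (rule Complex.DeMoivre)
    also have "real N * (2 * pi * of_int l / N) = 2 * pi * of_int l" using N by simp
    finally show ?thesis by (simp add: complex_eq_iff cos_int_2pin sin_int_2pin)
  qed
  ultimately have "(\<Sum>j<N. w ^ j) = 0" by (simp add: geometric_sum)
  then show ?thesis using False by (simp add: w_def)
qed simp

text \<open>A Cauchy estimate in which an average over roots of unity takes the place of the contour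
  integral.\<close>

lemma coeff_le_sup_circle:
  fixes Q :: "real poly"
  assumes "\<And>w::complex. cmod w = 1 \<Longrightarrow> cmod (peval Q w) \<le> M"
  shows "\<bar>coeff Q k\<bar> \<le> M"
proof (cases "k \<le> degree Q")
  case False
  have "0 \<le> M" using assms[of 1] norm_ge_zero[of "peval Q (1::complex)"] by (simp del: norm_ge_zero)
  then show ?thesis using False by (simp add: coeff_eq_0)
next
  case True
  \<comment> \<open>With more nodes than the degree, two exponents up to \<open>degree Q\<close>
    differ by less than \<open>N\<close>, so distinct powers do not alias.\<close>
  define N where "N = Suc (degree Q)"
  define w where "w j = cis (2 * pi * real j / N)" for j :: nat
  have N: "N > 0" by (simp add: N_def)
  have w: "cnj (w j) ^ k * w j ^ i = cis (2 * pi * of_int (int i - int k) / N) ^ j" for i j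
  proof -
    have "cnj (w j) ^ k * w j ^ i = cis (real k * - (2 * pi * real j / N) + real i * (2 * pi * real j / N))"
      by (simp only: w_def cis_cnj Complex.DeMoivre cis_mult)
    also have "real k * - (2 * pi * real j / N) + real i * (2 * pi * real j / N)
        = real j * (2 * pi * of_int (int i - int k) / N)"
      using N by (simp add: field_simps)
    finally show ?thesis by (simp only: Complex.DeMoivre)
  qed
  have "(\<Sum>j<N. cnj (w j) ^ k * peval Q (w j)) =
      (\<Sum>j<N. \<Sum>i\<le>degree Q. of_real (coeff Q i) * (cnj (w j) ^ k * w j ^ i))"
    unfolding peval_def sum_distrib_left by (simp add: scaleR_conv_of_real mult_ac)
  also have "\<dots> = (\<Sum>i\<le>degree Q. of_real (coeff Q i) * (\<Sum>j<N. cnj (w j) ^ k * w j ^ i))"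
    by (subst sum.swap) (simp only: sum_distrib_left)
  also have "\<dots> = (\<Sum>i\<le>degree Q. of_real (coeff Q i) * (if int i - int k = 0 then of_nat N else 0))"
    unfolding w
    by (intro sum.cong refl arg_cong2[where f="(*)"] sum_roots_of_unity N) (use True in \<open>auto simp: N_def\<close>)
  also have "\<dots> = of_real (coeff Q k) * of_nat N"
    using True by (simp add: if_distrib[of "(*) _"] sum.delta cong: if_cong)
  finally have eq: "(\<Sum>j<N. cnj (w j) ^ k * peval Q (w j)) = of_real (coeff Q k) * of_nat N" .
  have "\<bar>coeff Q k\<bar> * N = cmod (\<Sum>j<N. cnj (w j) ^ k * peval Q (w j))"
    unfolding eq by (simp add: norm_mult)
  also have "\<dots> \<le> (\<Sum>j<N. M)"
    by (rule sum_norm_le) (simp add: norm_mult norm_power w_def assms)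
  finally show ?thesis using N by (simp add: mult.commute)
qed

lemma power_mult_commuting:
  fixes a b :: "'a::monoid_mult"
  assumes "a * b = b * a"
  shows "(a * b) ^ n = a ^ n * b ^ n"
proof (induction n)
  case (Suc n)
  have "(a * b) ^ Suc n = a * (b * a ^ n) * b ^ n" by (simp add: Suc mult.assoc)
  also have "b * a ^ n = a ^ n * b" using power_commuting_commutes[OF assms, of n] by simp
  finally show ?case by (simp add: mult.assoc)
qed simp

text \<open>
  For a unitary \<open>u\<close> with real part \<open>x\<close>, \<open>u\<^sup>d q(x)\<close> is a polynomial in \<open>u\<close> whose coefficients are
  bounded by the supremum of \<open>q\<close> on \<open>[-1, 1]\<close>. This bounds \<open>q(x)\<close> up to a factor linear in the
  degree, which disappears on passing to the powers \<open>q ^ (2 ^ k)\<close>.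
\<close>

definition joukowski_poly :: "real poly \<Rightarrow> real poly"
  where "joukowski_poly q =
    (\<Sum>m\<le>degree q. smult (coeff q m) (monom 1 (degree q - m) * [:1/2, 0, 1/2:] ^ m))"

lemma degree_joukowski_poly: "degree (joukowski_poly q) \<le> 2 * degree q"
  unfolding joukowski_poly_def
proof (rule degree_sum_le)
  fix m assume m: "m \<in> {..degree q}"
  have "degree (monom 1 (degree q - m) * [:1/2, 0, 1/2:] ^ m :: real poly) \<le> (degree q - m) + 2 * m"
    by (rule order_trans[OF degree_mult_le], rule add_mono[OF degree_monom_le],
        rule order_trans[OF degree_power_le]) simp
  then show "degree (smult (coeff q m) (monom 1 (degree q - m) * [:1/2, 0, 1/2:] ^ m)) \<le> 2 * degree q"
    using m by (intro order_trans[OF degree_smult_le]) auto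
qed simp

lemma peval_monom: "peval (monom 1 k) u = u ^ k"
  by (induction k) (simp_all add: monom_Suc monom_0)

text \<open>An arbitrary inverse pair is allowed because the identity is applied twice: to a unitary
  with its adjoint and to a point of the unit circle with its conjugate.\<close>

lemma peval_joukowski_poly:
  fixes u v :: "'a::real_algebra_1"
  assumes uv: "u * v = 1" "v * u = 1"
  shows "peval (joukowski_poly q) u = u ^ degree q * peval q ((1/2) *\<^sub>R (u + v))"
proof -
  define x where "x = (1/2) *\<^sub>R (u + v)"
  have ux: "u * x = x * u" by (simp add: x_def algebra_simps uv)
  have ux': "u * x = peval [:1/2, 0, 1/2:] u" by (simp add: x_def algebra_simps uv)
  have "u ^ degree q * x ^ m = u ^ (degree q - m) * (u * x) ^ m" if "m \<le> degree q" for m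
    using that by (simp add: power_mult_commuting[OF ux] mult.assoc[symmetric] power_add[symmetric])
  then show ?thesis
    unfolding x_def[symmetric] joukowski_poly_def peval_sum peval_smult peval_mult peval_power
      peval_monom ux'[symmetric]
    by (simp add: peval_def sum_distrib_left)
qed

lemma norm_unitary_mult:
  fixes u :: "'a::unital_cstar_algebra"
  assumes "star u * u = 1"
  shows "norm (u * a) = norm a"
proof -
  have "(norm (u * a))\<^sup>2 = norm (star a * (star u * u) * a)"
    by (simp add: cstar_identity[symmetric] star_mult mult.assoc)
  then show ?thesis by (simp add: assms cstar_identity)
qed

lemma norm_unitary_power_mult:
  fixes u :: "'a::unital_cstar_algebra"
  assumes "star u * u = 1"
  shows "norm (u ^ k * a) = norm a"
  by (induction k) (simp_all add: norm_unitary_mult[OF assms] mult.assoc)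

lemma norm_peval_le_degree:
  fixes x :: "'a::unital_cstar_algebra"
  assumes sa: "star x = x" and nx: "norm x < 1"
    and M: "\<And>t. \<bar>t\<bar> \<le> 1 \<Longrightarrow> \<bar>poly q t\<bar> \<le> M"
  shows "norm (peval q x) \<le> (2 * real (degree q) + 1) * M"
proof -
  obtain u where u: "star u * u = 1" "u * star u = 1" "x = (1/2) *\<^sub>R (u + star u)"
    using selfadjoint_unitary_exists[OF sa nx] .
  have M0: "0 \<le> M" using M[of 0] by simp
  define Q where "Q = joukowski_poly q"
  have circ: "cmod (peval Q w) \<le> M" if w: "cmod w = 1" for w
  proof -
    have "w * cnj w = 1" using w by (simp add: complex_norm_square[symmetric])
    then have "peval Q w = w ^ degree q * peval q ((1/2) *\<^sub>R (w + cnj w))"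
      unfolding Q_def by (intro peval_joukowski_poly) (simp_all add: mult.commute)
    also have "(1/2) *\<^sub>R (w + cnj w) = of_real (Re w)" by (simp add: complex_eq_iff)
    finally have "cmod (peval Q w) = \<bar>poly q (Re w)\<bar>"
      by (simp add: peval_of_real norm_mult norm_power w)
    also have "\<dots> \<le> M" using w abs_Re_le_cmod[of w] by (intro M) simp
    finally show ?thesis .
  qed
  have nu: "norm (u ^ i) = 1" for i
    using norm_unitary_power_mult[OF u(1), of i 1] by simp
  have "norm (peval q x) = norm (peval Q u)"
    unfolding Q_def peval_joukowski_poly[OF u(2,1)] u(3)[symmetric]
    by (simp add: norm_unitary_power_mult[OF u(1)])
  also have "\<dots> \<le> (\<Sum>i\<le>degree Q. M)"
    unfolding peval_def by (rule sum_norm_le) (simp add: nu coeff_le_sup_circle[OF circ])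
  also have "\<dots> \<le> (2 * real (degree q) + 1) * M"
    using degree_joukowski_poly[of q] M0
    by (simp add: Q_def) (intro mult_right_mono, auto)
  finally show ?thesis .
qed

lemma norm_peval_le_aux:
  fixes x :: "'a::unital_cstar_algebra"
  assumes sa: "star x = x" and nx: "norm x < 1"
    and M: "\<And>t. \<bar>t\<bar> \<le> 1 \<Longrightarrow> \<bar>poly q t\<bar> \<le> M"
  shows "norm (peval q x) \<le> M"
proof (rule le_of_power_le_linear)
  show M0: "0 \<le> M" using M[of 0] by simp
  fix k
  have "norm (peval q x) ^ 2 ^ k = norm (peval (q ^ 2 ^ k) x)"
    by (simp add: peval_power norm_power_2_power star_peval sa)
  also have "\<dots> \<le> (2 * real (degree (q ^ 2 ^ k)) + 1) * M ^ 2 ^ k"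
    by (rule norm_peval_le_degree[OF sa nx])
      (simp add: poly_power power_abs power_mono M)
  also have "\<dots> \<le> (2 * real (degree q) * 2 ^ k + 1) * M ^ 2 ^ k"
  proof (intro mult_right_mono add_mono)
    have "real (degree (q ^ 2 ^ k)) \<le> real (degree q * 2 ^ k)"
      using degree_power_le of_nat_le_iff by blast
    then show "2 * real (degree (q ^ 2 ^ k)) \<le> 2 * real (degree q) * 2 ^ k" by simp
  qed (use M0 in auto)
  finally show "norm (peval q x) ^ 2 ^ k \<le> (2 * real (degree q) * 2 ^ k + 1) * M ^ 2 ^ k" .
qed

lemma peval_pcompose: "peval (pcompose p q) x = peval p (peval q x)"
  by (induction p) (simp_all add: pcompose_pCons peval_add peval_mult)

text \<open>The unitary exists only for norm strictly below 1. Hence \<open>x\<close> is rescaled to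
  norm 1 and approached by multiples of norm \<open>s < 1\<close>, using continuity of the
  polynomial.\<close>

lemma norm_peval_le:
  fixes x :: "'a::unital_cstar_algebra"
  assumes sa: "star x = x" and M: "\<And>t. \<bar>t\<bar> \<le> norm x \<Longrightarrow> \<bar>poly q t\<bar> \<le> M"
  shows "norm (peval q x) \<le> M"
proof (cases "x = 0")
  case True
  then have "peval q x = of_real (poly q 0)"
    using peval_of_real[of q 0, where 'a='a] by simp
  then show ?thesis using M[of 0] by simp
next
  case False
  define r where "r = norm x"
  define y where "y = (1/r) *\<^sub>R x"
  define p where "p = pcompose q [:0, r:]"
  have r: "r > 0" using False by (simp add: r_def)
  have ny: "norm y = 1" and x: "x = r *\<^sub>R y" using r by (simp_all add: y_def) (simp add: r_def)
  have sy: "star y = y" by (simp add: y_def star_scaleR sa)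
  have pM: "\<bar>poly p t\<bar> \<le> M" if "\<bar>t\<bar> \<le> 1" for t
    unfolding p_def poly_pcompose
    by (rule M) (use that r in \<open>simp add: abs_mult r_def[symmetric] mult_left_le_one_le\<close>)
  have "norm (peval p (s *\<^sub>R y)) \<le> M" if "s \<in> {0<..<1}" for s
    by (rule norm_peval_le_aux) (use that in \<open>auto simp: star_scaleR sy ny pM\<close>)
  moreover have "((\<lambda>s. norm (peval p (s *\<^sub>R y))) \<longlongrightarrow> norm (peval p (1 *\<^sub>R y))) (at_left (1::real))"
  proof (intro tendsto_norm)
    have "continuous_on UNIV (\<lambda>s. peval p (s *\<^sub>R y))"
      by (rule continuous_on_compose2[OF continuous_peval]) (auto intro!: continuous_intros)
    then show "((\<lambda>s. peval p (s *\<^sub>R y)) \<longlongrightarrow> peval p (1 *\<^sub>R y)) (at_left (1::real))"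
      unfolding continuous_on_eq_continuous_at[OF open_UNIV] isCont_def
      by (blast intro: filterlim_mono[OF _ order_refl at_le] subset_UNIV)
  qed
  moreover have "eventually (\<lambda>s. s \<in> {0<..<1}) (at_left (1::real))"
    by (rule eventually_at_leftI[of 0]) auto
  ultimately have "norm (peval p (1 *\<^sub>R y)) \<le> M"
    by (intro tendsto_upperbound) (auto elim: eventually_mono)
  then show ?thesis by (simp add: p_def peval_pcompose x)
qed

section \<open>Continuous functional calculus\<close>

text \<open>The value is the common limit along all approximating polynomial sequences, so that no
  sequence has to be chosen. The interval is determined by the norm alone and contains the
  spectrum.\<close>

definition cfc :: "'a::unital_cstar_algebra \<Rightarrow> (real \<Rightarrow> real) \<Rightarrow> 'a"
  where "cfc x f = (THE a. \<forall>p. (uniform_limit {- norm x..norm x} (\<lambda>k. poly (p k)) f sequentially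
    \<longrightarrow> (\<lambda>k. peval (p k) x) \<longlonglongrightarrow> a))"

lemma polynomial_approximation:
  fixes f :: "real \<Rightarrow> real"
  assumes "continuous_on {a..b} f"
  obtains p :: "nat \<Rightarrow> real poly" where "uniform_limit {a..b} (\<lambda>k. poly (p k)) f sequentially"
proof -
  have "\<exists>p. \<forall>t\<in>{a..b}. \<bar>f t - poly p t\<bar> < inverse (real (Suc k))" for k
  proof -
    obtain g where g: "real_polynomial_function g" "\<And>t. t \<in> {a..b} \<Longrightarrow> \<bar>f t - g t\<bar> < inverse (real (Suc k))"
      using Stone_Weierstrass_real_polynomial_function[OF compact_Icc assms, of "inverse (real (Suc k))"] by auto
    obtain c N where "g = (\<lambda>x. \<Sum>i\<le>N. c i * x ^ i)"
      using g(1) real_polynomial_function_iff_sum by auto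
    then have "g t = poly (\<Sum>i\<le>N. monom (c i) i) t" for t
      by (simp add: poly_sum poly_monom)
    then show ?thesis using g(2) by metis
  qed
  then obtain p where p: "\<And>k t. t \<in> {a..b} \<Longrightarrow> \<bar>f t - poly (p k) t\<bar> < inverse (real (Suc k))"
    by metis
  have "uniform_limit {a..b} (\<lambda>k. poly (p k)) f sequentially"
  proof (rule uniform_limitI)
    fix e :: real assume "e > 0"
    then obtain N where N: "inverse (real (Suc N)) < e" using reals_Archimedean by blast
    have "dist (poly (p k) t) (f t) < e" if "k \<ge> N" "t \<in> {a..b}" for k t
    proof -
      have "inverse (real (Suc k)) \<le> inverse (real (Suc N))" using that by simp
      then show ?thesis using p[OF that(2), of k] N
        by (simp only: dist_real_def abs_minus_commute[of "poly (p k) t"])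
    qed
    then show "\<forall>\<^sub>F k in sequentially. \<forall>t\<in>{a..b}. dist (poly (p k) t) (f t) < e"
      by (auto simp: eventually_sequentially intro!: exI[of _ N])
  qed
  then show thesis using that by blast
qed

text \<open>By \<open>norm_peval_le\<close>, uniform closeness of polynomials bounds the distance of
  their values at \<open>x\<close>. Hence the values are Cauchy, and any two sequences approximating
  \<open>f\<close> have the same limit, so the description in \<open>cfc\<close> has a unique
  solution.\<close>

lemma cfc_tendsto:
  fixes x :: "'a::unital_cstar_algebra"
  assumes sa: "star x = x" and f: "continuous_on {- norm x..norm x} f"
    and p: "uniform_limit {- norm x..norm x} (\<lambda>k. poly (p k)) f sequentially"
  shows "(\<lambda>k. peval (p k) x) \<longlonglongrightarrow> cfc x f"
proof -
  let ?I = "{- norm x..norm x}"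
  let ?u = "\<lambda>q. uniform_limit ?I (\<lambda>k. poly (q k)) f sequentially"
  have close: "norm (peval q x - peval q' x) \<le> e"
    if "\<And>t. t \<in> ?I \<Longrightarrow> dist (poly q t) (poly q' t) \<le> e" for q q' :: "real poly" and e
    unfolding peval_diff[symmetric] using that
    by (intro norm_peval_le[OF sa]) (auto simp: dist_real_def abs_le_iff)
  have "Cauchy (\<lambda>k. peval (p k) x)"
    unfolding Cauchy_def
  proof (intro allI impI)
    fix e :: real assume e: "e > 0"
    have "uniformly_Cauchy_on ?I (\<lambda>k. poly (p k))"
      using p by (meson uniformly_convergent_Cauchy uniformly_convergentI)
    then obtain M where M: "\<And>t m n. t \<in> ?I \<Longrightarrow> m \<ge> M \<Longrightarrow> n \<ge> M \<Longrightarrow> dist (poly (p m) t) (poly (p n) t) < e/2"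
      using e unfolding uniformly_Cauchy_on_def by (metis half_gt_zero)
    have "dist (peval (p m) x) (peval (p n) x) < e" if "m \<ge> M" "n \<ge> M" for m n
    proof -
      have "norm (peval (p m) x - peval (p n) x) \<le> e/2"
        by (rule close) (use M that in \<open>force intro: less_imp_le\<close>)
      then show ?thesis using e by (simp add: dist_norm)
    qed
    then show "\<exists>M. \<forall>m\<ge>M. \<forall>n\<ge>M. dist (peval (p m) x) (peval (p n) x) < e" by blast
  qed
  then obtain a where a: "(\<lambda>k. peval (p k) x) \<longlonglongrightarrow> a"
    using convergent_def convergent_eq_Cauchy by blast
  have all: "(\<lambda>k. peval (q k) x) \<longlonglongrightarrow> a" if q: "?u q" for q
  proof -
    have "(\<lambda>k. peval (q k) x - peval (p k) x) \<longlonglongrightarrow> 0"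
    proof (rule LIMSEQ_I)
      fix e :: real assume e: "e > 0"
      have "\<forall>\<^sub>F k in sequentially. \<forall>t\<in>?I. dist (poly (q k) t) (f t) < e/4"
        and "\<forall>\<^sub>F k in sequentially. \<forall>t\<in>?I. dist (poly (p k) t) (f t) < e/4"
        using uniform_limitD[OF q, of "e/4"] uniform_limitD[OF p, of "e/4"] e by simp_all
      then have "\<forall>\<^sub>F k in sequentially. norm (peval (q k) x - peval (p k) x - 0) < e"
      proof eventually_elim
        case (elim k)
        have "norm (peval (q k) x - peval (p k) x) \<le> e/2"
        proof (rule close)
          fix t assume "t \<in> ?I"
          then show "dist (poly (q k) t) (poly (p k) t) \<le> e/2"
            using elim dist_triangle2[of "poly (q k) t" "poly (p k) t" "f t"] by fastforce
        qed
        then show ?case using e by simp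
      qed
      then show "\<exists>no. \<forall>k\<ge>no. norm (peval (q k) x - peval (p k) x - 0) < e"
        by (simp add: eventually_sequentially)
    qed
    from tendsto_add[OF this a] show ?thesis by simp
  qed
  have "cfc x f = a"
    unfolding cfc_def
  proof (rule the_equality)
    show "\<forall>p. ?u p \<longrightarrow> (\<lambda>k. peval (p k) x) \<longlonglongrightarrow> a" using all by blast
    show "b = a" if "\<forall>p. ?u p \<longrightarrow> (\<lambda>k. peval (p k) x) \<longlonglongrightarrow> b" for b
      using that p a LIMSEQ_unique by blast
  qed
  with a show ?thesis by simp
qed

abbreviation cfc_domain :: "'a::unital_cstar_algebra \<Rightarrow> real set"
  where "cfc_domain x \<equiv> {- norm x..norm x}"

lemma cfc_domain_bounded:
  assumes "continuous_on (cfc_domain x) f"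
  shows "bounded (f ` cfc_domain x)"
  using assms compact_Icc compact_continuous_image compact_imp_bounded by blast

context
  fixes x :: "'a::unital_cstar_algebra"
  assumes sa: "star x = x"
begin

lemma cfc_poly: "cfc x (poly p) = peval p x"
proof -
  have "(\<lambda>k. peval p x) \<longlonglongrightarrow> cfc x (poly p)"
    by (rule cfc_tendsto[OF sa, of "poly p" "\<lambda>_. p"])
      (auto intro!: continuous_intros uniform_limitI)
  then show ?thesis using LIMSEQ_unique[OF _ tendsto_const] by blast
qed

lemma cfc_const: "cfc x (\<lambda>_. c) = c *\<^sub>R 1"
proof -
  have "(\<lambda>_. c) = poly [:c:]" by (simp add: fun_eq_iff)
  then show ?thesis using cfc_poly[of "[:c:]"] by simp
qed

lemma cfc_one: "cfc x (\<lambda>_. 1) = 1"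
  by (simp add: cfc_const)

lemma cfc_ident: "cfc x (\<lambda>t. t) = x"
proof -
  have "(\<lambda>t::real. t) = poly [:0, 1:]" by (simp add: fun_eq_iff)
  then show ?thesis using cfc_poly[of "[:0, 1:]"] by simp
qed

lemma cfc_add:
  assumes f: "continuous_on (cfc_domain x) f" and g: "continuous_on (cfc_domain x) g"
  shows "cfc x (\<lambda>t. f t + g t) = cfc x f + cfc x g"
proof -
  obtain p where p: "uniform_limit (cfc_domain x) (\<lambda>k. poly (p k)) f sequentially"
    using polynomial_approximation[OF f] .
  obtain q where q: "uniform_limit (cfc_domain x) (\<lambda>k. poly (q k)) g sequentially"
    using polynomial_approximation[OF g] .
  have "(\<lambda>k. peval (p k + q k) x) \<longlonglongrightarrow> cfc x (\<lambda>t. f t + g t)"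
    using uniform_limit_add[OF p q] f g
    by (intro cfc_tendsto[OF sa]) (auto intro: continuous_intros simp: poly_add[abs_def])
  moreover have "(\<lambda>k. peval (p k + q k) x) \<longlonglongrightarrow> cfc x f + cfc x g"
    unfolding peval_add by (intro tendsto_add cfc_tendsto[OF sa] f g p q)
  ultimately show ?thesis by (rule LIMSEQ_unique)
qed

lemma cfc_mult:
  assumes f: "continuous_on (cfc_domain x) f" and g: "continuous_on (cfc_domain x) g"
  shows "cfc x (\<lambda>t. f t * g t) = cfc x f * cfc x g"
proof -
  obtain p where p: "uniform_limit (cfc_domain x) (\<lambda>k. poly (p k)) f sequentially"
    using polynomial_approximation[OF f] .
  obtain q where q: "uniform_limit (cfc_domain x) (\<lambda>k. poly (q k)) g sequentially"
    using polynomial_approximation[OF g] .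
  have "(\<lambda>k. peval (p k * q k) x) \<longlonglongrightarrow> cfc x (\<lambda>t. f t * g t)"
    using uniform_lim_mult[OF p q] cfc_domain_bounded[OF f] cfc_domain_bounded[OF g] f g
    by (intro cfc_tendsto[OF sa]) (auto intro: continuous_intros simp: poly_mult[abs_def])
  moreover have "(\<lambda>k. peval (p k * q k) x) \<longlonglongrightarrow> cfc x f * cfc x g"
    unfolding peval_mult by (intro tendsto_mult cfc_tendsto[OF sa] f g p q)
  ultimately show ?thesis by (rule LIMSEQ_unique)
qed

lemma cfc_commute:
  assumes f: "continuous_on (cfc_domain x) f" and g: "continuous_on (cfc_domain x) g"
  shows "cfc x f * cfc x g = cfc x g * cfc x f"
  using cfc_mult[OF f g] cfc_mult[OF g f] by (simp add: mult.commute)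

lemma cfc_cmult:
  assumes f: "continuous_on (cfc_domain x) f"
  shows "cfc x (\<lambda>t. c * f t) = c *\<^sub>R cfc x f"
  using cfc_mult[of "\<lambda>_. c", OF _ f] by (simp add: cfc_const)

lemma cfc_diff:
  assumes f: "continuous_on (cfc_domain x) f" and g: "continuous_on (cfc_domain x) g"
  shows "cfc x (\<lambda>t. f t - g t) = cfc x f - cfc x g"
  using cfc_add[OF f, of "\<lambda>t. -1 * g t"] cfc_cmult[OF g, of "-1"] g
  by (simp add: continuous_on_minus)

lemma cfc_power:
  assumes f: "continuous_on (cfc_domain x) f"
  shows "cfc x (\<lambda>t. f t ^ n) = cfc x f ^ n"
  by (induction n) (simp_all add: cfc_one cfc_mult f continuous_on_power)

lemma cfc_sum:
  assumes f: "\<And>i. i \<in> I \<Longrightarrow> continuous_on (cfc_domain x) (f i)"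
  shows "cfc x (\<lambda>t. \<Sum>i\<in>I. f i t) = (\<Sum>i\<in>I. cfc x (f i))"
  using f
  by (induction I rule: infinite_finite_induct)
    (simp_all add: cfc_const cfc_add continuous_on_sum)

lemma star_cfc:
  assumes f: "continuous_on (cfc_domain x) f"
  shows "star (cfc x f) = cfc x f"
proof -
  obtain p where p: "uniform_limit (cfc_domain x) (\<lambda>k. poly (p k)) f sequentially"
    using polynomial_approximation[OF f] .
  note lim = cfc_tendsto[OF sa f p]
  have "(\<lambda>k. star (peval (p k) x)) \<longlonglongrightarrow> star (cfc x f)"
    by (rule bounded_linear.tendsto[OF bounded_linear_star lim])
  then show ?thesis using lim LIMSEQ_unique by (simp add: star_peval[OF sa]) blast
qed

lemma norm_cfc_le:
  assumes f: "continuous_on (cfc_domain x) f" and M: "\<And>t. \<bar>t\<bar> \<le> norm x \<Longrightarrow> \<bar>f t\<bar> \<le> M"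
  shows "norm (cfc x f) \<le> M"
proof -
  obtain p where p: "uniform_limit (cfc_domain x) (\<lambda>k. poly (p k)) f sequentially"
    using polynomial_approximation[OF f] .
  have "norm (cfc x f) \<le> M + e" if e: "e > 0" for e
  proof (rule tendsto_upperbound[OF tendsto_norm[OF cfc_tendsto[OF sa f p]]])
    show "\<forall>\<^sub>F k in sequentially. norm (peval (p k) x) \<le> M + e"
      using uniform_limitD[OF p e]
    proof eventually_elim
      case (elim k)
      show ?case
      proof (rule norm_peval_le[OF sa])
        fix t assume "\<bar>t\<bar> \<le> norm x"
        then show "\<bar>poly (p k) t\<bar> \<le> M + e"
          using elim[rule_format, of t] M[of t] by (auto simp: dist_real_def abs_le_iff)
      qed
    qed
  qed simp
  then show ?thesis by (rule field_le_epsilon)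
qed

lemma cfc_cong:
  assumes f: "continuous_on (cfc_domain x) f" and eq: "\<And>t. \<bar>t\<bar> \<le> norm x \<Longrightarrow> f t = g t"
  shows "cfc x g = cfc x f"
proof -
  have g: "continuous_on (cfc_domain x) g"
    by (rule continuous_on_eq[OF f]) (use eq in auto)
  have "norm (cfc x (\<lambda>t. g t - f t)) \<le> 0"
    by (rule norm_cfc_le) (use eq f g in \<open>auto intro: continuous_intros\<close>)
  then show ?thesis using cfc_diff[OF g f] by simp
qed

end

section \<open>A partition of unity by hat functions\<close>

definition hat :: "real \<Rightarrow> real"
  where "hat r = max 0 (1 - \<bar>r\<bar>)"

lemma hat_nonneg: "0 \<le> hat r"
  and hat_nonzero: "hat r \<noteq> 0 \<Longrightarrow> \<bar>r\<bar> < 1"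
  by (auto simp: hat_def)

lemma continuous_on_hat [continuous_intros]:
  "continuous_on S f \<Longrightarrow> continuous_on S (\<lambda>t. hat (f t))"
  unfolding hat_def by (intro continuous_intros)

text \<open>A difference of two shifted ramps makes sums over integer translates telescope.\<close>

lemma hat_telescope: "hat r = max 0 (min 1 (r + 1)) - max 0 (min 1 r)"
  by (auto simp: hat_def)

lemma sum_hat:
  assumes "\<bar>r\<bar> \<le> real K"
  shows "(\<Sum>i\<in>{-int K..int K}. hat (r - of_int i)) = 1"
proof -
  define F where "F m = max 0 (min 1 (r - of_int m))" for m :: int
  have hat: "hat (r - of_int m) = F (m - 1) - F m" for m
    by (simp add: hat_telescope F_def algebra_simps)
  have "(\<Sum>i\<in>{a..a + int n}. F (i - 1) - F i) = F (a - 1) - F (a + int n)" for a n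
  proof (induction n)
    case (Suc n)
    have "{a..a + int (Suc n)} = insert (a + int (Suc n)) {a..a + int n}" by auto
    then show ?case by (simp add: Suc)
  qed simp
  \<comment> \<open>At the two ends of the telescope the ramps equal 1 and 0, because
    \<open>r + K + 1 >= 1\<close> and \<open>r - K <= 0\<close>.\<close>
  from this[of "- int K" "2 * K"] show ?thesis using assms by (simp add: hat F_def)
qed

section \<open>Extracting coefficients of vector-valued polynomials\<close>

text \<open>Lagrange interpolation at the nodes 0 to \<open>n\<close> reproduces each
  \<open>t ^ k\<close>; the weight \<open>w i\<close> is the coefficient of degree \<open>j\<close>
  of the \<open>i\<close>-th Lagrange polynomial.\<close>

lemma moment_weights_exist:
  fixes n j :: nat
  obtains w :: "nat \<Rightarrow> real"
  where "\<And>k. k \<le> n \<Longrightarrow> (\<Sum>i\<le>n. w i * real i ^ k) = (if k = j then 1 else 0)"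
proof -
  define l :: "nat \<Rightarrow> real poly" where
    "l i = smult (inverse (\<Prod>m\<in>{..n} - {i}. real i - real m)) (\<Prod>m\<in>{..n} - {i}. [:- real m, 1:])" for i
  have l: "poly (l i) (real k) = (if k = i then 1 else 0)" if "i \<le> n" "k \<le> n" for i k
    using that by (auto simp: l_def poly_prod)
  have deg: "degree (l i) \<le> n" if "i \<le> n" for i
  proof -
    have "degree (\<Prod>m\<in>{..n} - {i}. [:- real m, 1:]) \<le> (\<Sum>m\<in>{..n} - {i}. degree [:- real m, 1:])"
      using degree_prod_sum_le[of "{..n} - {i}" "\<lambda>m. [:- real m, 1:]"] by (simp add: o_def)
    also have "\<dots> = n" using that by simp
    finally show ?thesis unfolding l_def by (meson degree_smult_le order_trans)
  qed
  have "(\<Sum>i\<le>n. coeff (l i) j * real i ^ k) = (if k = j then 1 else 0)" if k: "k \<le> n" for k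
  proof -
    define p where "p = (\<Sum>i\<le>n. smult (real i ^ k) (l i))"
    have "monom 1 k = p"
    proof (rule poly_eqI_degree[of "real ` {..n}"])
      show "poly (monom 1 k) t = poly p t" if t: "t \<in> real ` {..n}" for t
      proof -
        obtain i where i: "i \<le> n" "t = real i" using t by auto
        have "poly p t = (\<Sum>m\<le>n. real m ^ k * (if i = m then 1 else 0))"
          unfolding p_def poly_sum by (intro sum.cong refl) (simp add: l i)
        also have "\<dots> = (\<Sum>m\<le>n. if i = m then real m ^ k else 0)"
          by (intro sum.cong) auto
        finally show ?thesis using i by (simp add: poly_monom)
      qed
      have c: "card (real ` {..n}) = Suc n" by (simp add: card_image)
      show "degree (monom 1 k :: real poly) < card (real ` {..n})"
        unfolding c using k degree_monom_le[of "1::real" k] by simp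
      have "degree p \<le> n" unfolding p_def
      proof (rule degree_sum_le)
        show "degree (smult (real i ^ k) (l i)) \<le> n" if "i \<in> {..n}" for i
          using deg[of i] that degree_smult_le[of "real i ^ k" "l i"] by simp
      qed simp
      then show "degree p < card (real ` {..n})" unfolding c by simp
    qed
    then have "coeff p j = coeff (monom 1 k) j" by simp
    then show ?thesis by (simp add: p_def coeff_sum mult.commute)
  qed
  then show thesis by (rule that)
qed

lemma polynomial_coeff_extraction:
  fixes n j :: nat
  assumes "j \<le> n"
  obtains w :: "nat \<Rightarrow> real"
  where "\<And>v :: nat \<Rightarrow> 'v::real_vector. (\<Sum>i\<le>n. w i *\<^sub>R (\<Sum>k\<le>n. real i ^ k *\<^sub>R v k)) = v j"
proof -
  obtain w where w: "\<And>k. k \<le> n \<Longrightarrow> (\<Sum>i\<le>n. w i * real i ^ k) = (if k = j then 1 else 0)"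
    using moment_weights_exist[of n j] by blast
  have "(\<Sum>i\<le>n. w i *\<^sub>R (\<Sum>k\<le>n. real i ^ k *\<^sub>R v k)) = v j" for v :: "nat \<Rightarrow> 'v"
  proof -
    have "(\<Sum>i\<le>n. w i *\<^sub>R (\<Sum>k\<le>n. real i ^ k *\<^sub>R v k)) = (\<Sum>k\<le>n. (\<Sum>i\<le>n. w i * real i ^ k) *\<^sub>R v k)"
      unfolding scaleR_sum_right scaleR_sum_left scaleR_scaleR by (rule sum.swap)
    also have "\<dots> = (\<Sum>k\<le>n. if k = j then v k else 0)"
      by (intro sum.cong refl) (simp add: w)
    finally show ?thesis using assms by simp
  qed
  then show thesis by (rule that)
qed

lemma polynomial_coeffs_eq:
  fixes u v :: "nat \<Rightarrow> 'v::real_vector"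
  assumes "\<And>t::real. (\<Sum>k\<le>n. t ^ k *\<^sub>R u k) = (\<Sum>k\<le>n. t ^ k *\<^sub>R v k)" and j: "j \<le> n"
  shows "u j = v j"
proof -
  obtain w where "\<And>v :: nat \<Rightarrow> 'v. (\<Sum>i\<le>n. w i *\<^sub>R (\<Sum>k\<le>n. real i ^ k *\<^sub>R v k)) = v j"
    using polynomial_coeff_extraction[OF j] by blast
  from this[of u] this[of v] show ?thesis by (simp add: assms(1))
qed

section \<open>Symmetric multilinear forms\<close>

text \<open>
  Symmetry is built into the representation: the \<open>n\<close> arguments form a multiset.
\<close>

locale symmetric_form =
  fixes n :: nat and M :: "'a::complex_vector multiset \<Rightarrow> 'b::complex_vector"
  assumes add: "size X + 1 = n \<Longrightarrow> M (add_mset (a + b) X) = M (add_mset a X) + M (add_mset b X)"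
    and scaleC: "size X + 1 = n \<Longrightarrow> M (add_mset (c *\<^sub>C a) X) = c *\<^sub>C M (add_mset a X)"
begin

lemma scaleR: "size X + 1 = n \<Longrightarrow> M (add_mset (r *\<^sub>R a) X) = r *\<^sub>R M (add_mset a X)"
  by (simp add: scaleR_scaleC scaleC)

lemma zero: "size X + 1 = n \<Longrightarrow> M (add_mset 0 X) = 0"
  using scaleR[of X 0 0] by simp

lemma diff: "size X + 1 = n \<Longrightarrow> M (add_mset (a - b) X) = M (add_mset a X) - M (add_mset b X)"
  using add[of X "a - b" b] by simp

lemma sum: "size X + 1 = n \<Longrightarrow> M (add_mset (\<Sum>i\<in>I. f i) X) = (\<Sum>i\<in>I. M (add_mset (f i) X))"
  by (induction I rule: infinite_finite_induct) (simp_all add: zero add)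

lemma replicate_scaleC:
  "size Z + k = n \<Longrightarrow> M (replicate_mset k (c *\<^sub>C a) + Z) = c ^ k *\<^sub>C M (replicate_mset k a + Z)"
proof (induction k arbitrary: Z)
  case (Suc k)
  have "M (replicate_mset (Suc k) (c *\<^sub>C a) + Z) = c *\<^sub>C M (replicate_mset k (c *\<^sub>C a) + add_mset a Z)"
    using Suc.prems by (simp add: scaleC)
  also have "\<dots> = c *\<^sub>C c ^ k *\<^sub>C M (replicate_mset k a + add_mset a Z)"
    using Suc.prems by (subst Suc.IH) auto
  finally show ?case by (simp add: scaleC_scaleC)
qed simp

text \<open>\<open>Z\<close> collects the fixed arguments; the induction on \<open>k\<close> hands
  one argument at a time over to it.\<close>

lemma binomial:
  "size Z + k = n \<Longrightarrow> M (replicate_mset k (a + b) + Z) =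
    (\<Sum>j\<le>k. real (k choose j) *\<^sub>R M (replicate_mset j b + replicate_mset (k - j) a + Z))"
proof (induction k arbitrary: Z)
  case (Suc k)
  define G where "G j = M (replicate_mset j b + replicate_mset (Suc k - j) a + Z)" for j
  have "M (replicate_mset (Suc k) (a + b) + Z) =
      M (replicate_mset k (a + b) + add_mset a Z) + M (replicate_mset k (a + b) + add_mset b Z)"
    using Suc.prems by (simp add: add)
  also have "M (replicate_mset k (a + b) + add_mset a Z) = (\<Sum>j\<le>k. real (k choose j) *\<^sub>R G j)"
    using Suc.prems by (subst Suc.IH) (auto simp: G_def Suc_diff_le intro!: sum.cong)
  also have "\<dots> = (\<Sum>j\<le>Suc k. real (k choose j) *\<^sub>R G j)" by simp
  also have "\<dots> = G 0 + (\<Sum>j\<le>k. real (k choose Suc j) *\<^sub>R G (Suc j))"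
    by (subst sum.atMost_Suc_shift) simp
  also have "M (replicate_mset k (a + b) + add_mset b Z) = (\<Sum>j\<le>k. real (k choose j) *\<^sub>R G (Suc j))"
    using Suc.prems by (subst Suc.IH) (auto simp: G_def intro!: sum.cong)
  also have "G 0 + (\<Sum>j\<le>k. real (k choose Suc j) *\<^sub>R G (Suc j)) + (\<Sum>j\<le>k. real (k choose j) *\<^sub>R G (Suc j))
     = G 0 + (\<Sum>j\<le>k. real (Suc k choose Suc j) *\<^sub>R G (Suc j))"
    by (simp add: sum.distrib scaleR_add_left)
  also have "\<dots> = (\<Sum>j\<le>Suc k. real (Suc k choose j) *\<^sub>R G j)"
    by (simp add: sum.atMost_Suc_shift del: sum.atMost_Suc binomial_Suc_Suc)
  finally show ?case by (simp only: G_def)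
qed simp

lemma binomial_scaleC:
  assumes "size Z + k = n"
  shows "M (replicate_mset k (a + c *\<^sub>C b) + Z) =
    (\<Sum>j\<le>k. c ^ j *\<^sub>C real (k choose j) *\<^sub>R M (replicate_mset j b + replicate_mset (k - j) a + Z))"
proof -
  have "real (k choose j) *\<^sub>R M (replicate_mset j (c *\<^sub>C b) + replicate_mset (k - j) a + Z) =
      c ^ j *\<^sub>C real (k choose j) *\<^sub>R M (replicate_mset j b + replicate_mset (k - j) a + Z)"
    if "j \<in> {..k}" for j
  proof -
    have "size (replicate_mset (k - j) a + Z) + j = n" using assms that by simp
    from replicate_scaleC[OF this, of c b] show ?thesis
      by (simp only: add.assoc scaleR_scaleC scaleC_scaleC mult.commute)
  qed
  then show ?thesis
    by (subst binomial[OF assms]) (rule sum.cong[OF refl])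
qed

lemma binomial_scaleR:
  assumes "size Z + k = n"
  shows "M (replicate_mset k (a + t *\<^sub>R b) + Z) =
    (\<Sum>j\<le>k. t ^ j *\<^sub>R real (k choose j) *\<^sub>R M (replicate_mset j b + replicate_mset (k - j) a + Z))"
proof -
  have "t ^ j *\<^sub>R v = of_real t ^ j *\<^sub>C v" for j and v :: 'b
    by (simp only: scaleR_scaleC of_real_power)
  then show ?thesis using binomial_scaleC[OF assms, of a "of_real t" b]
    by (simp only: scaleR_scaleC[of t b])
qed

text \<open>\<open>M\<close> at \<open>k + 1\<close> copies of \<open>a + t b\<close> is a
  polynomial in \<open>t\<close> whose linear coefficient is \<open>k + 1\<close> times the left
  side. The weights are quantified before \<open>Z\<close>, \<open>a\<close> and \<open>b\<close>
  because \<open>bounded_aux\<close> needs a bound uniform in them.\<close>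

lemma polarization:
  "\<exists>w :: nat \<Rightarrow> real. \<forall>Z a b. size Z + Suc k = n \<longrightarrow>
    M (add_mset b (replicate_mset k a + Z)) =
    (\<Sum>i\<le>Suc k. w i *\<^sub>R M (replicate_mset (Suc k) (a + real i *\<^sub>R b) + Z))"
proof -
  obtain w where w: "\<And>v :: nat \<Rightarrow> 'b. (\<Sum>i\<le>Suc k. w i *\<^sub>R (\<Sum>j\<le>Suc k. real i ^ j *\<^sub>R v j)) = v 1"
    using polynomial_coeff_extraction[of 1 "Suc k"] by auto
  have "M (add_mset b (replicate_mset k a + Z)) =
    (\<Sum>i\<le>Suc k. (w i / real (Suc k)) *\<^sub>R M (replicate_mset (Suc k) (a + real i *\<^sub>R b) + Z))"
    if "size Z + Suc k = n" for Z a b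
  proof -
    have "(\<Sum>i\<le>Suc k. w i *\<^sub>R M (replicate_mset (Suc k) (a + real i *\<^sub>R b) + Z))
      = real (Suc k) *\<^sub>R M (add_mset b (replicate_mset k a + Z))"
      unfolding binomial_scaleR[OF that] w by simp
    then have "(1 / real (Suc k)) *\<^sub>R (\<Sum>i\<le>Suc k. w i *\<^sub>R M (replicate_mset (Suc k) (a + real i *\<^sub>R b) + Z))
      = M (add_mset b (replicate_mset k a + Z))" by simp
    then show ?thesis by (simp only: scaleR_sum_right scaleR_scaleR) simp
  qed
  then show ?thesis by (intro exI allI impI)
qed

end

section \<open>Boundedness of orthogonally additive forms\<close>

text \<open>\<open>norm_le\<close> controls \<open>M\<close> only on the diagonal of self-adjoint
  elements; bounds at distinct arguments have to be derived from it.\<close>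

locale orthogonally_additive_form = symmetric_form n M
  for n :: nat and M :: "'a::unital_cstar_algebra multiset \<Rightarrow> 'b::unital_cstar_algebra" +
  assumes norm_le: "star a = a \<Longrightarrow> norm (M (replicate_mset n a)) \<le> norm a ^ n"
    and orth_add: "a * b = 0 \<Longrightarrow> b * a = 0 \<Longrightarrow>
      M (replicate_mset n (a + b)) = M (replicate_mset n a) + M (replicate_mset n b)"
begin

text \<open>Starting on the diagonal, polarization frees one argument per step: \<open>j\<close>
  arguments are arbitrary while the other \<open>n - j\<close> still coincide.\<close>

lemma bounded_aux:
  "j \<le> n \<Longrightarrow> R \<ge> 0 \<Longrightarrow> \<exists>C. \<forall>Z a. size Z = j \<longrightarrow> (\<forall>z\<in>set_mset (add_mset a Z). star z = z \<and> norm z \<le> R) \<longrightarrow>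
    norm (M (replicate_mset (n - j) a + Z)) \<le> C"
proof (induction j arbitrary: R)
  case 0
  then show ?case
    using order_trans[OF norm_le power_mono] by (intro exI[of _ "R ^ n"]) auto
next
  case (Suc j)
  define k where "k = n - Suc j"
  have k: "n - j = Suc k" and n: "j + Suc k = n" using Suc.prems by (auto simp: k_def)
  \<comment> \<open>Polarization evaluates at \<open>a + i b\<close> with \<open>i <= n\<close>, so
    the induction hypothesis is taken on a ball larger by the factor \<open>n + 1\<close>.\<close>
  have "0 \<le> real (n + 1) * R" using Suc.prems by simp
  from Suc.IH[OF Suc_leD[OF Suc.prems(1)] this] obtain C where C: "\<forall>Z a. size Z = j \<longrightarrow>
      (\<forall>z\<in>set_mset (add_mset a Z). star z = z \<and> norm z \<le> real (n + 1) * R) \<longrightarrow>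
      norm (M (replicate_mset (Suc k) a + Z)) \<le> C"
    unfolding k by blast
  obtain w where w: "\<forall>Z a b. size Z + Suc k = n \<longrightarrow> M (add_mset b (replicate_mset k a + Z)) =
      (\<Sum>i\<le>Suc k. w i *\<^sub>R M (replicate_mset (Suc k) (a + real i *\<^sub>R b) + Z))"
    using polarization[of k] by blast
  have "norm (M (replicate_mset k a + Z)) \<le> (\<Sum>i\<le>Suc k. \<bar>w i\<bar> * C)"
    if Z: "size Z = Suc j" "\<And>z. z \<in> set_mset (add_mset a Z) \<Longrightarrow> star z = z \<and> norm z \<le> R" for Z a
  proof -
    obtain b Y where Y: "Z = add_mset b Y" using size_eq_Suc_imp_eq_union[OF Z(1)] by blast
    have sY: "size Y = j" using Z(1) Y by simp
    have le: "norm z \<le> R" "norm z \<le> real (n + 1) * R" if "z \<in> set_mset (add_mset a Z)" for z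
    proof -
      show "norm z \<le> R" using Z(2)[OF that] by simp
      also have "R \<le> real (n + 1) * R" using Suc.prems by (simp add: algebra_simps)
      finally show "norm z \<le> real (n + 1) * R" .
    qed
    have "norm (M (replicate_mset (Suc k) (a + real i *\<^sub>R b) + Y)) \<le> C" if "i \<le> Suc k" for i
    proof (rule C[rule_format, OF sY])
      fix z assume z: "z \<in> set_mset (add_mset (a + real i *\<^sub>R b) Y)"
      show "star z = z \<and> norm z \<le> real (n + 1) * R"
      proof (cases "z \<in># Y")
        case True
        then show ?thesis using Z(2)[of z] le(2)[of z] Y by auto
      next
        case False
        then have z: "z = a + real i *\<^sub>R b" using z by auto
        have "norm z \<le> norm a + real i * norm b"
          unfolding z by (rule order_trans[OF norm_triangle_ineq]) simp
        also have "\<dots> \<le> R + real n * R"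
          using le(1)[of a] le(1)[of b] Y that n Suc.prems by (intro add_mono mult_mono) auto
        finally show ?thesis using Z(2)[of a] Z(2)[of b] Y
          by (auto simp: z star_add star_scaleR algebra_simps)
      qed
    qed
    then have "norm (\<Sum>i\<le>Suc k. w i *\<^sub>R M (replicate_mset (Suc k) (a + real i *\<^sub>R b) + Y))
        \<le> (\<Sum>i\<le>Suc k. \<bar>w i\<bar> * C)"
      by (intro sum_norm_le) (simp add: mult_left_mono)
    then show ?thesis using w[rule_format, of Y b a] n sY Y by simp
  qed
  then show ?case unfolding k_def by blast
qed

lemma bounded_ball:
  assumes "R \<ge> 0"
  obtains C where "C \<ge> 0" "\<And>Z. size Z = n \<Longrightarrow> (\<And>z. z \<in># Z \<Longrightarrow> star z = z \<and> norm z \<le> R) \<Longrightarrow> norm (M Z) \<le> C"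
proof -
  obtain C where C: "\<And>Z a. size Z = n \<Longrightarrow> (\<And>z. z \<in> set_mset (add_mset a Z) \<Longrightarrow> star z = z \<and> norm z \<le> R) \<Longrightarrow>
      norm (M (replicate_mset (n - n) a + Z)) \<le> C"
    using bounded_aux[OF order_refl assms] by metis
  have "norm (M Z) \<le> max C 0" if "size Z = n" "\<And>z. z \<in># Z \<Longrightarrow> star z = z \<and> norm z \<le> R" for Z
    \<comment> \<open>For \<open>j = n\<close> no copies of \<open>a\<close> remain; 0 is a
      placeholder that satisfies the bound.\<close>
    using C[OF that(1), of 0] that(2) assms by force
  then show thesis using that[of "max C 0"] by auto
qed

text \<open>Homogeneity reduces \<open>r\<close> to norm 1, and \<open>1 <= R\<close> keeps the
  normalized element in the ball.\<close>

lemma bounded_linear_factor: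
  assumes "R \<ge> 1"
  obtains C where "C \<ge> 0" "\<And>r X. size X + 1 = n \<Longrightarrow> star r = r \<Longrightarrow>
    (\<And>z. z \<in># X \<Longrightarrow> star z = z \<and> norm z \<le> R) \<Longrightarrow> norm (M (add_mset r X)) \<le> C * norm r"
proof -
  obtain C where C: "C \<ge> 0" "\<And>Z. size Z = n \<Longrightarrow> (\<And>z. z \<in># Z \<Longrightarrow> star z = z \<and> norm z \<le> R) \<Longrightarrow> norm (M Z) \<le> C"
    using bounded_ball[of R] assms by auto
  have "norm (M (add_mset r X)) \<le> C * norm r"
    if X: "size X + 1 = n" "star r = r" "\<And>z. z \<in># X \<Longrightarrow> star z = z \<and> norm z \<le> R" for r X
  proof (cases "r = 0")
    case True
    then show ?thesis using zero[OF X(1)] by simp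
  next
    case False
    define r' where "r' = (1 / norm r) *\<^sub>R r"
    have r: "r = norm r *\<^sub>R r'" using False by (simp add: r'_def)
    have "norm (M (add_mset r' X)) \<le> C"
      by (rule C(2)) (use X False assms in \<open>auto simp: r'_def star_scaleR\<close>)
    then have "norm r * norm (M (add_mset r' X)) \<le> norm r * C" by (rule mult_left_mono) simp
    moreover have "M (add_mset r X) = norm r *\<^sub>R M (add_mset r' X)"
      using scaleR[OF X(1), of "norm r" r'] r by simp
    ultimately show ?thesis by (simp add: mult.commute)
  qed
  then show thesis using that C(1) by blast
qed

lemma bounded_bilinear_factors:
  assumes Z: "size Z + 2 = n" "\<And>z. z \<in># Z \<Longrightarrow> star z = z"
  obtains C where "C \<ge> 0" "\<And>f g. star f = f \<Longrightarrow> star g = g \<Longrightarrow>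
    norm (M (add_mset f (add_mset g Z))) \<le> C * norm f * norm g"
proof -
  define R where "R = Max (insert 1 (norm ` set_mset Z))"
  have R: "R \<ge> 1" "\<And>z. z \<in># Z \<Longrightarrow> norm z \<le> R" by (auto simp: R_def)
  obtain C where C: "C \<ge> 0" "\<And>r X. size X + 1 = n \<Longrightarrow> star r = r \<Longrightarrow>
    (\<And>z. z \<in># X \<Longrightarrow> star z = z \<and> norm z \<le> R) \<Longrightarrow> norm (M (add_mset r X)) \<le> C * norm r"
    using bounded_linear_factor[OF R(1)] by blast
  have "norm (M (add_mset f (add_mset g Z))) \<le> C * norm f * norm g" if fg: "star f = f" "star g = g" for f g
  proof (cases "g = 0")
    case True
    then show ?thesis using zero[of "add_mset f Z"] Z by (simp add: add_mset_commute)
  next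
    case False
    define g' where "g' = (1 / norm g) *\<^sub>R g"
    have g: "g = norm g *\<^sub>R g'" using False by (simp add: g'_def)
    have "norm (M (add_mset f (add_mset g' Z))) \<le> C * norm f"
      by (rule C(2)) (use Z R fg False in \<open>auto simp: g'_def star_scaleR\<close>)
    moreover have "M (add_mset f (add_mset g Z)) = norm g *\<^sub>R M (add_mset f (add_mset g' Z))"
      using scaleR[of "add_mset f Z" "norm g" g'] Z g by (simp add: add_mset_commute)
    ultimately show ?thesis by (simp add: mult.commute mult_left_mono)
  qed
  then show thesis using that C(1) by blast
qed

text \<open>The copies of \<open>f\<close> are exchanged for \<open>f'\<close> one at a time; those
  already exchanged move into \<open>Z\<close>.\<close>

lemma replicate_lipschitz:
  assumes C: "\<And>r X. size X + 1 = n \<Longrightarrow> star r = r \<Longrightarrow>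
      (\<And>z. z \<in># X \<Longrightarrow> star z = z \<and> norm z \<le> R) \<Longrightarrow> norm (M (add_mset r X)) \<le> C * norm r"
    and f: "star f = f" "norm f \<le> R" and f': "star f' = f'" "norm f' \<le> R"
  shows "size Z + k = n \<Longrightarrow> (\<And>z. z \<in># Z \<Longrightarrow> star z = z \<and> norm z \<le> R) \<Longrightarrow>
    norm (M (replicate_mset k f + Z) - M (replicate_mset k f' + Z)) \<le> real k * (C * norm (f - f'))"
proof (induction k arbitrary: Z)
  case (Suc k)
  have sz: "size (replicate_mset k f + Z) + 1 = n" using Suc.prems by simp
  have "M (replicate_mset (Suc k) f + Z) - M (replicate_mset (Suc k) f' + Z) =
     M (add_mset (f - f') (replicate_mset k f + Z)) +
     (M (replicate_mset k f + add_mset f' Z) - M (replicate_mset k f' + add_mset f' Z))"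
    by (simp add: diff[OF sz])
  also have "norm \<dots> \<le> C * norm (f - f') + real k * (C * norm (f - f'))"
  proof (intro norm_triangle_mono)
    show "norm (M (add_mset (f - f') (replicate_mset k f + Z))) \<le> C * norm (f - f')"
      by (rule C[OF sz]) (use f f' Suc.prems in \<open>auto simp: star_diff split: if_splits\<close>)
    show "norm (M (replicate_mset k f + add_mset f' Z) - M (replicate_mset k f' + add_mset f' Z))
        \<le> real k * (C * norm (f - f'))"
      by (rule Suc.IH) (use f' Suc.prems in auto)
  qed
  finally show ?case by (simp add: algebra_simps)
qed simp

text \<open>Orthogonal additivity along \<open>f + t g\<close> leaves only the powers
  \<open>t ^ 0\<close> and \<open>t ^ n\<close>, so comparing coefficients kills every mixed
  term.\<close>

lemma orthogonal_mixed_zero: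
  assumes fg: "f * g = 0" "g * f = 0" and km: "0 < k" "0 < m" "k + m = n"
  shows "M (replicate_mset k f + replicate_mset m g) = 0"
proof -
  define v where "v j = real (n choose j) *\<^sub>R M (replicate_mset j g + replicate_mset (n - j) f)" for j
  have "v m = (if m = 0 then v 0 else if m = n then v n else 0)"
  proof (rule polynomial_coeffs_eq[where n=n and u=v])
    fix t :: real
    have "(\<Sum>j\<le>n. t ^ j *\<^sub>R v j) = M (replicate_mset n (f + t *\<^sub>R g))"
      using binomial_scaleR[of "{#}" n f t g] by (simp add: v_def)
    also have "\<dots> = M (replicate_mset n f) + M (replicate_mset n (t *\<^sub>R g))"
      by (rule orth_add) (simp_all add: fg)
    also have "M (replicate_mset n (t *\<^sub>R g)) = t ^ n *\<^sub>R M (replicate_mset n g)"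
      using replicate_scaleC[of "{#}" n "of_real t" g] by (simp add: scaleR_scaleC)
    also have "M (replicate_mset n f) + t ^ n *\<^sub>R M (replicate_mset n g) =
       (\<Sum>j\<in>{0, n}. t ^ j *\<^sub>R (if j = 0 then v 0 else if j = n then v n else 0))"
      using km by (simp add: v_def)
    also have "\<dots> = (\<Sum>j\<le>n. t ^ j *\<^sub>R (if j = 0 then v 0 else if j = n then v n else 0))"
      by (rule sum.mono_neutral_left) auto
    finally show "(\<Sum>j\<le>n. t ^ j *\<^sub>R v j) =
       (\<Sum>j\<le>n. t ^ j *\<^sub>R (if j = 0 then v 0 else if j = n then v n else 0))" .
  qed (use km in simp)
  then have "v m = 0" using km by simp
  moreover have "n - m = k" "n choose m \<noteq> 0" using km by auto
  ultimately show ?thesis by (simp add: v_def add.commute)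
qed

end

section \<open>Orthogonally additive forms\<close>

definition cfc_range :: "'a::unital_cstar_algebra \<Rightarrow> 'a set"
  where "cfc_range x = cfc x ` {f. continuous_on (cfc_domain x) f}"

lemma cfc_in_range [intro]: "continuous_on (cfc_domain x) f \<Longrightarrow> cfc x f \<in> cfc_range x"
  by (simp add: cfc_range_def)

lemma cfc_rangeE:
  assumes "a \<in> cfc_range x"
  obtains f where "continuous_on (cfc_domain x) f" "a = cfc x f"
  using assms by (auto simp: cfc_range_def)

context
  fixes x :: "'a::unital_cstar_algebra"
  assumes sa: "star x = x"
begin

lemma cfc_range_add: "a \<in> cfc_range x \<Longrightarrow> b \<in> cfc_range x \<Longrightarrow> a + b \<in> cfc_range x"
  by (elim cfc_rangeE) (auto simp: cfc_add[OF sa, symmetric] continuous_on_add)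

lemma cfc_range_mult: "a \<in> cfc_range x \<Longrightarrow> b \<in> cfc_range x \<Longrightarrow> a * b \<in> cfc_range x"
  by (elim cfc_rangeE) (auto simp: cfc_mult[OF sa, symmetric] continuous_on_mult)

lemma cfc_range_diff: "a \<in> cfc_range x \<Longrightarrow> b \<in> cfc_range x \<Longrightarrow> a - b \<in> cfc_range x"
  by (elim cfc_rangeE) (auto simp: cfc_diff[OF sa, symmetric] continuous_on_diff)

lemma cfc_range_scaleR: "a \<in> cfc_range x \<Longrightarrow> c *\<^sub>R a \<in> cfc_range x"
  by (elim cfc_rangeE) (auto simp: cfc_cmult[OF sa, symmetric] continuous_on_mult_left)

lemma cfc_range_one: "1 \<in> cfc_range x"
  unfolding cfc_one[OF sa, symmetric] by auto

lemma cfc_range_self: "x \<in> cfc_range x"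
  using cfc_in_range[of x "\<lambda>t. t"] by (simp add: cfc_ident[OF sa])

lemma cfc_range_power: "a \<in> cfc_range x \<Longrightarrow> a ^ k \<in> cfc_range x"
  by (induction k) (auto simp: cfc_range_one cfc_range_mult)

lemma cfc_range_sum: "(\<And>i. i \<in> I \<Longrightarrow> f i \<in> cfc_range x) \<Longrightarrow> (\<Sum>i\<in>I. f i) \<in> cfc_range x"
  using cfc_range_scaleR[OF cfc_range_one, of 0]
  by (induction I rule: infinite_finite_induct) (auto simp: cfc_range_add)

lemma cfc_range_commute: "a \<in> cfc_range x \<Longrightarrow> b \<in> cfc_range x \<Longrightarrow> a * b = b * a"
  by (elim cfc_rangeE) (simp add: cfc_commute[OF sa])

lemma cfc_range_star: "a \<in> cfc_range x \<Longrightarrow> star a = a"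
  by (elim cfc_rangeE) (simp add: star_cfc[OF sa])

text \<open>
  \<open>f'\<close> arises from \<open>f\<close> by soft thresholding. The cut-off \<open>f * q\<close> is a multiple of \<open>f\<close>, so it
  annihilates everything that \<open>f\<close> annihilates although zero products in the algebra need not come
  from zero products of functions.
\<close>

lemma cfc_range_cutoff:
  assumes f: "f \<in> cfc_range x" and e: "e > 0"
  obtains f' p q where "f' \<in> cfc_range x" "p \<in> cfc_range x" "q \<in> cfc_range x"
    "norm (f - f') \<le> e" "f' = f * p" "(1 - f * q) * f' = 0"
proof -
  obtain F where F: "continuous_on (cfc_domain x) F" "f = cfc x F"
    using f by (rule cfc_rangeE)
  \<comment> \<open>\<open>F * Pp\<close> is \<open>F\<close> moved towards 0 by \<open>e\<close>,
    and \<open>Q\<close> is \<open>1 / F\<close> wherever \<open>F\<close> is at least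
    \<open>e\<close> in absolute value. The maxima keep the denominators positive.\<close>
  define Pp where "Pp t = max 0 (\<bar>F t\<bar> - e) / max \<bar>F t\<bar> e" for t
  define Q where "Q t = F t / max (\<bar>F t\<bar>\<^sup>2) (e\<^sup>2)" for t
  have cP: "continuous_on (cfc_domain x) Pp" unfolding Pp_def
    by (intro continuous_intros F) (use e in \<open>auto simp: max_def\<close>)
  have cQ: "continuous_on (cfc_domain x) Q" unfolding Q_def
    by (intro continuous_intros F) (use e in \<open>auto simp: max_def\<close>)
  have cFP: "continuous_on (cfc_domain x) (\<lambda>t. F t * Pp t)"
    and cFQ: "continuous_on (cfc_domain x) (\<lambda>t. F t * Q t)"
    by (intro continuous_intros F cP cQ)+
  show thesis
  proof (rule that[of "f * cfc x Pp" "cfc x Pp" "cfc x Q"])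
    show "f * cfc x Pp \<in> cfc_range x" "cfc x Pp \<in> cfc_range x" "cfc x Q \<in> cfc_range x"
      using cP cQ f by (auto intro: cfc_range_mult)
    have "\<bar>F t - F t * Pp t\<bar> \<le> e" for t
    proof -
      have "F t - F t * Pp t = F t * (1 - Pp t)" by (simp add: algebra_simps)
      moreover have "1 - Pp t = (if \<bar>F t\<bar> \<le> e then 1 else e / \<bar>F t\<bar>)"
        using e by (auto simp: Pp_def max_def field_simps)
      ultimately show ?thesis using e by (auto simp: abs_mult)
    qed
    then have "norm (cfc x (\<lambda>t. F t - F t * Pp t)) \<le> e"
      by (intro norm_cfc_le[OF sa] continuous_intros F cP)
    then show "norm (f - f * cfc x Pp) \<le> e"
      using F cP cFP by (simp add: cfc_diff[OF sa] cfc_mult[OF sa])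
    have "(1 - F t * Q t) * (F t * Pp t) = 0" for t
    proof (cases "\<bar>F t\<bar> \<le> e")
      case True
      then show ?thesis by (simp add: Pp_def)
    next
      case False
      then have "e\<^sup>2 \<le> \<bar>F t\<bar>\<^sup>2" using e by (intro power_mono) auto
      then have "F t * Q t = 1" using False e by (simp add: Q_def max_def power2_eq_square)
      then show ?thesis by simp
    qed
    then have "cfc x (\<lambda>t. (1 - F t * Q t) * (F t * Pp t)) = 0"
      by (simp only: cfc_const[OF sa] scaleR_zero_left)
    then show "(1 - f * cfc x Q) * (f * cfc x Pp) = 0"
      using F cP cQ cFP cFQ
      by (simp add: cfc_diff[OF sa] cfc_mult[OF sa] cfc_one[OF sa] continuous_on_diff)
  qed simp
qed

end

section \<open>Locality, and moving a factor between arguments\<close>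

context orthogonally_additive_form
begin

context
  fixes x :: 'a
  assumes sa: "star x = x"
begin

text \<open>
  A further argument \<open>h\<close> is split as \<open>h a + h (1 - a)\<close> with a cut-off \<open>a\<close> for \<open>f\<close>. The first part
  joins \<open>f\<close>, being orthogonal to \<open>g\<close>, and the second joins \<open>g\<close>, being orthogonal to \<open>f\<close>.
\<close>

lemma local_mixed_zero:
  assumes "f \<in> cfc_range x" "g \<in> cfc_range x" "f * g = 0" "set_mset Z \<subseteq> cfc_range x"
    "0 < k" "0 < m" "k + m + size Z = n"
  shows "M (replicate_mset k f + replicate_mset m g + Z) = 0"
  using assms
proof (induction Z arbitrary: f g k m)
  case empty
  then show ?case
    using orthogonal_mixed_zero[of f g k m] cfc_range_commute[OF sa] by simp
next
  case (add h Z)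
  note W = cfc_range_add[OF sa] cfc_range_mult[OF sa] cfc_range_diff[OF sa] cfc_range_scaleR[OF sa]
    cfc_range_one[OF sa]
  note comm = cfc_range_commute[OF sa]
  have h: "h \<in> cfc_range x" and Z: "set_mset Z \<subseteq> cfc_range x"
    using add.prems by auto
  have size: "k + m + size Z + 1 = n" using add.prems by simp
  have cut: "M (replicate_mset k f' + replicate_mset m g + add_mset h Z) = 0"
    if f': "f' \<in> cfc_range x" "p \<in> cfc_range x" "q \<in> cfc_range x" "f' = f * p" "(1 - f * q) * f' = 0"
    for f' p q
  proof -
    define a where "a = f * q"
    have a: "a \<in> cfc_range x" using W add.prems f' by (simp add: a_def)
    have ag: "a * g = 0"
    proof -
      have "a * g = q * (f * g)" using comm[OF add.prems(1) f'(3)] by (simp add: a_def mult.assoc)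
      then show ?thesis using add.prems by simp
    qed
    have fg: "f' * g = 0"
    proof -
      have "f' * g = p * (f * g)" using comm[OF add.prems(1) f'(2)] by (simp add: f'(4) mult.assoc)
      then show ?thesis using add.prems by simp
    qed
    \<comment> \<open>Polarization expresses this through \<open>k + 1\<close> copies of
      \<open>f' + i h a\<close>. These are orthogonal to \<open>g\<close>, so the induction
      hypothesis applies with one argument fewer in \<open>Z\<close>.\<close>
    have "M (add_mset (h * a) (replicate_mset k f' + (replicate_mset m g + Z))) = 0"
    proof -
      obtain w where w: "\<forall>Z a b. size Z + Suc k = n \<longrightarrow> M (add_mset b (replicate_mset k a + Z)) =
          (\<Sum>i\<le>Suc k. w i *\<^sub>R M (replicate_mset (Suc k) (a + real i *\<^sub>R b) + Z))"
        using polarization[of k] by blast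
      have "M (replicate_mset (Suc k) (f' + real i *\<^sub>R (h * a)) + (replicate_mset m g + Z)) = 0" for i
        unfolding add.assoc[symmetric]
      proof (rule add.IH)
        show "(f' + real i *\<^sub>R (h * a)) * g = 0" by (simp add: distrib_right fg mult.assoc ag)
      qed (use W a h f' add.prems Z size in auto)
      then show ?thesis using w[rule_format, of "replicate_mset m g + Z" "h * a" f'] size by simp
    qed
    moreover have "M (add_mset (h - h * a) (replicate_mset k f' + (replicate_mset m g + Z))) = 0"
    proof -
      obtain w where w: "\<forall>Z a b. size Z + Suc m = n \<longrightarrow> M (add_mset b (replicate_mset m a + Z)) =
          (\<Sum>i\<le>Suc m. w i *\<^sub>R M (replicate_mset (Suc m) (a + real i *\<^sub>R b) + Z))"
        using polarization[of m] by blast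
      have "M (replicate_mset k f' + replicate_mset (Suc m) (g + real i *\<^sub>R (h - h * a)) + Z) = 0" for i
      proof (rule add.IH)
        have "h - h * a = h * (1 - a)" by (simp add: algebra_simps)
        then have "(h - h * a) * f' = 0" using f'(5) by (simp add: a_def[symmetric] mult.assoc)
        then have "f' * (h - h * a) = 0" using comm W a h f' by metis
        then show "f' * (g + real i *\<^sub>R (h - h * a)) = 0" by (simp add: distrib_left fg)
      qed (use W a h f' add.prems Z size in auto)
      then have "M (replicate_mset (Suc m) (g + real i *\<^sub>R (h - h * a)) + (replicate_mset k f' + Z)) = 0" for i
        by (simp only: ac_simps)
      then show ?thesis using w[rule_format, of "replicate_mset k f' + Z" "h - h * a" g] size
        by (simp add: ac_simps)
    qed
    ultimately have "M (add_mset (h * a + (h - h * a)) (replicate_mset k f' + (replicate_mset m g + Z))) = 0"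
      using size by (subst symmetric_form.add[OF symmetric_form_axioms]) auto
    then show ?thesis by (simp add: ac_simps)
  qed
  \<comment> \<open>\<open>R\<close> dominates every argument; the last summand 1 leaves room for
    \<open>f'\<close>, which lies within distance 1 of \<open>f\<close>.\<close>
  define R where "R = Max (insert 1 (norm ` set_mset (add_mset g (add_mset h Z)))) + norm f + 1"
  have "1 \<le> Max (insert 1 (norm ` set_mset (add_mset g (add_mset h Z))))" by (rule Max_ge) auto
  then have R1: "R \<ge> 1" "norm f + 1 \<le> R" by (auto simp: R_def)
  have R2: "norm z \<le> R" if "z \<in># add_mset g (add_mset h Z)" for z
  proof -
    have "norm z \<le> Max (insert 1 (norm ` set_mset (add_mset g (add_mset h Z))))"
      using that by (intro Max_ge) auto
    then show ?thesis by (simp add: R_def add_increasing2)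
  qed
  obtain C where C: "C \<ge> 0" "\<And>r X. size X + 1 = n \<Longrightarrow> star r = r \<Longrightarrow>
      (\<And>z. z \<in># X \<Longrightarrow> star z = z \<and> norm z \<le> R) \<Longrightarrow> norm (M (add_mset r X)) \<le> C * norm r"
    using bounded_linear_factor[OF R1(1)] by blast
  have "norm (M (replicate_mset k f + (replicate_mset m g + add_mset h Z))) \<le> 0 + e" if "e > 0" for e
  proof -
    \<comment> \<open>Chosen so that the Lipschitz bound \<open>k * C * d\<close> is at most
      \<open>e\<close>.\<close>
    define d where "d = min 1 (e / (real k * C + 1))"
    have kC: "0 \<le> real k * C" using C(1) by simp
    have d: "d > 0" "d \<le> 1" using that kC by (auto simp: d_def intro!: divide_pos_pos add_nonneg_pos)
    obtain f' p q where f': "f' \<in> cfc_range x" "p \<in> cfc_range x" "q \<in> cfc_range x"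
        "norm (f - f') \<le> d" "f' = f * p" "(1 - f * q) * f' = 0"
      using cfc_range_cutoff[OF sa add.prems(1) d(1)] .
    have nf': "norm f' \<le> R" using f'(4) d R1 norm_triangle_sub[of f' f] by (simp add: norm_minus_commute)
    have "norm (M (replicate_mset k f + (replicate_mset m g + add_mset h Z))
        - M (replicate_mset k f' + (replicate_mset m g + add_mset h Z))) \<le> real k * (C * norm (f - f'))"
      by (rule replicate_lipschitz[OF C(2)])
        (use f' nf' R1 R2 add.prems Z h cfc_range_star[OF sa] in \<open>auto split: if_splits\<close>)
    also have "M (replicate_mset k f' + (replicate_mset m g + add_mset h Z)) = 0"
      using cut[OF f'(1,2,3,5,6)] by (simp only: add.assoc)
    also have "real k * (C * norm (f - f')) \<le> real k * C * (e / (real k * C + 1))"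
      using f'(4) C(1) unfolding mult.assoc[symmetric]
      by (intro mult_left_mono) (auto simp: d_def)
    also have "\<dots> \<le> e"
      using that kC by (simp add: field_simps)
    finally show ?thesis by simp
  qed
  then have "norm (M (replicate_mset k f + (replicate_mset m g + add_mset h Z))) \<le> 0"
    by (rule field_le_epsilon)
  then show ?case by (simp only: add.assoc norm_le_zero_iff)
qed

lemma local_bilinear_zero:
  assumes "f \<in> cfc_range x" "g \<in> cfc_range x" "f * g = 0" "set_mset Z \<subseteq> cfc_range x" "size Z + 2 = n"
  shows "M (add_mset f (add_mset g Z)) = 0"
  using local_mixed_zero[OF assms(1-4), of 1 1] assms(5)
  by (simp add: add_mset_commute)

text \<open>
  The staircase \<open>s\<^sub>c(r) = r - (2/\<pi>) arcsin (sin (\<pi>/2 (r - c)))\<close> stays within distance 1 of \<open>r\<close> and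
  equals \<open>i\<close> on the support of the hat centred at \<open>i\<close> whenever \<open>i \<equiv> c\<close> modulo 4. On each of the four
  residue classes, \<open>x\<close> may therefore be replaced by a function that is constant on every hat.
\<close>

lemma shift_factor:
  assumes f: "f \<in> cfc_range x" and g: "g \<in> cfc_range x" and Z: "set_mset Z \<subseteq> cfc_range x" "size Z + 2 = n"
  shows "M (add_mset (x * f) (add_mset g Z)) = M (add_mset f (add_mset (x * g) Z))"
proof -
  note W = cfc_range_add[OF sa] cfc_range_mult[OF sa] cfc_range_diff[OF sa] cfc_range_scaleR[OF sa]
    cfc_range_one[OF sa] cfc_range_self[OF sa]
  note comm = cfc_range_commute[OF sa]
  define B where "B f g = M (add_mset f (add_mset g Z))" for f g
  have B_diff1: "B (f - f') g = B f g - B f' g" for f f' g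
    unfolding B_def using Z by (simp add: diff)
  have B_diff2: "B f (g - g') = B f g - B f g'" for f g g'
    unfolding B_def add_mset_commute[of f] using Z by (simp add: diff)
  have B_scale1: "B (c *\<^sub>R f) g = c *\<^sub>R B f g" for c f g
    unfolding B_def using Z by (simp add: scaleR)
  have B_scale2: "B f (c *\<^sub>R g) = c *\<^sub>R B f g" for c f g
    unfolding B_def add_mset_commute[of f] using Z by (simp add: scaleR)
  have B_sum1: "B (\<Sum>i\<in>I. h i) g = (\<Sum>i\<in>I. B (h i) g)" for I and h :: "'i \<Rightarrow> 'a" and g
    unfolding B_def using Z by (simp add: sum)
  have B0: "B f g = 0" if "f \<in> cfc_range x" "g \<in> cfc_range x" "f * g = 0" for f g
    unfolding B_def by (rule local_bilinear_zero[OF that Z])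
  obtain C where C: "C \<ge> 0" "\<And>f g. star f = f \<Longrightarrow> star g = g \<Longrightarrow> norm (B f g) \<le> C * norm f * norm g"
    using bounded_bilinear_factors[of Z] Z cfc_range_star[OF sa] unfolding B_def by (metis subsetD)
  \<comment> \<open>The 8 counts two error terms in each of four residue classes.\<close>
  define K where "K = 8 * C * norm f * norm g"
  have main: "norm (B (x * f) g - B f (x * g)) \<le> K / real N" if N: "N > 0" for N :: nat
  proof -
    define L where "L = nat \<lceil>real N * norm x\<rceil>"
    define e where "e i = cfc x (\<lambda>t. hat (real N * t - of_int i))" for i :: int
    define I where "I c = {i \<in> {- int L..int L}. i mod 4 = c}" for c :: int
    define st where "st c t = (real N * t - (2 / pi) * arcsin (sin (pi / 2 * (real N * t - of_int c)))) / real N"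
      for c :: int and t :: real
    define s where "s c = cfc x (st c)" for c
    have cont_hat: "continuous_on S (\<lambda>t. hat (real N * t - of_int i))" for S and i :: int
      by (intro continuous_intros)
    have cont_st: "continuous_on S (st c)" for S c
      unfolding st_def by (intro continuous_intros) (use N in auto)
    have e: "e i \<in> cfc_range x" for i unfolding e_def by (intro cfc_in_range cont_hat)
    have s: "s c \<in> cfc_range x" for c unfolding s_def by (intro cfc_in_range cont_st)
    have fin: "finite (I c)" for c by (rule finite_subset[of _ "{- int L..int L}"]) (auto simp: I_def)
    have arc: "\<bar>(2 / pi) * arcsin (sin y)\<bar> \<le> 1" for y
    proof -
      have "\<bar>arcsin (sin y)\<bar> \<le> pi / 2"
        using arcsin_lbound[of "sin y"] arcsin_ubound[of "sin y"] by (simp add: abs_le_iff)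
      then show ?thesis by (simp add: abs_mult field_simps)
    qed
    have xs: "norm (x - s c) \<le> 1 / real N" for c
    proof -
      have "x - s c = cfc x (\<lambda>t. t - st c t)"
        unfolding s_def by (simp add: cfc_diff[OF sa] cont_st cfc_ident[OF sa])
      also have "norm \<dots> \<le> 1 / real N"
      proof (rule norm_cfc_le[OF sa])
        fix t
        have "t - st c t = ((2 / pi) * arcsin (sin (pi / 2 * (real N * t - of_int c)))) / real N"
          using N by (simp add: st_def diff_divide_distrib)
        then show "\<bar>t - st c t\<bar> \<le> 1 / real N"
          using divide_right_mono[OF arc[of "pi / 2 * (real N * t - of_int c)"], of "real N"]
          by (simp only: abs_divide abs_of_nat)
      qed (intro continuous_intros cont_st)
      finally show ?thesis .
    qed
    have es: "e i * (s c - (of_int i / real N) *\<^sub>R 1) = 0" if "i \<in> I c" for i c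
    proof -
      have "hat (real N * t - of_int i) * (st c t - of_int i / real N) = 0" for t
      proof (cases "hat (real N * t - of_int i) = 0")
        case False
        then have r: "\<bar>real N * t - of_int i\<bar> < 1" by (rule hat_nonzero)
        obtain k where k: "i = c + 4 * k" using \<open>i \<in> I c\<close>
          by (auto simp: I_def intro!: that[of "i div 4"])
        have "sin (pi / 2 * (real N * t - of_int c)) = sin (pi / 2 * (real N * t - of_int i) + 2 * pi * of_int k)"
          by (simp add: k algebra_simps)
        also have "\<dots> = sin (pi / 2 * (real N * t - of_int i))"
          by (simp add: sin_add cos_int_2pin sin_int_2pin)
        also have "arcsin \<dots> = pi / 2 * (real N * t - of_int i)"
          using r pi_gt_zero mult_strict_left_mono[of "real N * t - of_int i" 1 "pi / 2"]
            mult_strict_left_mono[of "-1" "real N * t - of_int i" "pi / 2"]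
          by (intro arcsin_sin) (auto simp: abs_less_iff)
        finally have arc_eq: "arcsin (sin (pi / 2 * (real N * t - of_int c))) = pi / 2 * (real N * t - of_int i)" .
        have "st c t = of_int i / real N" unfolding st_def arc_eq by (simp add: field_simps)
        then show ?thesis by simp
      qed simp
      then have "cfc x (\<lambda>t. hat (real N * t - of_int i) * (st c t - of_int i / real N)) = 0"
        by (simp only: cfc_const[OF sa] scaleR_zero_left)
      then show ?thesis
        unfolding e_def s_def
        by (simp add: cfc_mult[OF sa] cfc_diff[OF sa] cont_hat cont_st continuous_on_diff cfc_const[OF sa])
    qed
    \<comment> \<open>Estimating hat by hat would produce about \<open>2 * L\<close> errors of order
      \<open>1 / N\<close>, a total that does not shrink. Gathered into four elements of norm at
      most 1, the hats incur only four errors of that order.\<close>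
    define E where "E c = (\<Sum>i\<in>I c. e i)" for c
    have E: "E c \<in> cfc_range x" for c unfolding E_def by (rule cfc_range_sum[OF sa e])
    have sum1: "(\<Sum>i\<in>{- int L..int L}. hat (real N * t - of_int i)) = 1" if "\<bar>t\<bar> \<le> norm x" for t
    proof (rule sum_hat)
      have "\<bar>real N * t\<bar> \<le> real N * norm x" using that by (simp add: abs_mult mult_left_mono)
      then show "\<bar>real N * t\<bar> \<le> real L" unfolding L_def by linarith
    qed
    have normE: "norm (E c) \<le> 1" for c
    proof -
      have "E c = cfc x (\<lambda>t. \<Sum>i\<in>I c. hat (real N * t - of_int i))"
        unfolding E_def e_def by (rule cfc_sum[OF sa, symmetric]) (rule cont_hat)
      also have "norm \<dots> \<le> 1"
      proof (rule norm_cfc_le[OF sa])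
        fix t assume t: "\<bar>t\<bar> \<le> norm x"
        have "(\<Sum>i\<in>I c. hat (real N * t - of_int i)) \<le> (\<Sum>i\<in>{- int L..int L}. hat (real N * t - of_int i))"
          by (rule sum_mono2) (auto simp: I_def hat_nonneg)
        then show "\<bar>\<Sum>i\<in>I c. hat (real N * t - of_int i)\<bar> \<le> 1"
          using sum1[OF t] by (simp add: abs_of_nonneg sum_nonneg hat_nonneg)
      qed (intro continuous_intros)
      finally show ?thesis .
    qed
    have sumE: "(\<Sum>c\<in>{0..<4}. E c) = 1"
    proof -
      have "(\<Sum>c\<in>{0..<4}. E c) = (\<Sum>i\<in>(\<Union>c\<in>{0..<4}. I c). e i)"
        unfolding E_def by (rule sum.UNION_disjoint[symmetric], simp, simp add: fin, auto simp: I_def)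
      also have "(\<Union>c\<in>{0..<4}. I c) = {- int L..int L}" by (auto simp: I_def)
      also have "(\<Sum>i\<in>{- int L..int L}. e i) = cfc x (\<lambda>t. \<Sum>i\<in>{- int L..int L}. hat (real N * t - of_int i))"
        unfolding e_def by (rule cfc_sum[OF sa, symmetric]) (rule cont_hat)
      also have "\<dots> = cfc x (\<lambda>_. 1)"
        by (rule cfc_cong[OF sa]) (auto simp: sum1)
      finally show ?thesis by (simp add: cfc_one[OF sa])
    qed
    \<comment> \<open>On the hat \<open>e i\<close> the staircase acts as the scalar
      \<open>r\<close>: directly in the first argument, and by locality in the second.\<close>
    have swap: "B (s c * (E c * f)) g = B (E c * f) (s c * g)" for c
    proof -
      have "B (s c * (e i * f)) g = B (e i * f) (s c * g)" if i: "i \<in> I c" for i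
      proof -
        define r where "r = of_int i / real N"
        have z: "e i * (s c - r *\<^sub>R 1) = 0" using es[OF i] by (simp add: r_def)
        then have "s c * e i = r *\<^sub>R e i" using comm[OF s e] by (simp add: algebra_simps)
        then have "B (s c * (e i * f)) g = r *\<^sub>R B (e i * f) g"
          by (simp add: mult.assoc[symmetric] B_scale1)
        moreover have "B (e i * f) ((s c - r *\<^sub>R 1) * g) = 0"
        proof (rule B0)
          have "e i * f * ((s c - r *\<^sub>R 1) * g) = f * (e i * (s c - r *\<^sub>R 1)) * g"
            using comm[OF e f] by (simp add: mult.assoc)
          then show "e i * f * ((s c - r *\<^sub>R 1) * g) = 0" by (simp add: z)
        qed (use W e s f g in auto)
        then have "B (e i * f) (s c * g) = r *\<^sub>R B (e i * f) g"
          by (simp add: left_diff_distrib B_diff2 B_scale2)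
        ultimately show ?thesis by simp
      qed
      then show ?thesis
        by (simp add: E_def sum_distrib_left sum_distrib_right B_sum1)
    qed
    have bound: "norm (B (x * (E c * f)) g - B (E c * f) (x * g)) \<le> 2 * C * norm f * norm g / real N" for c
    proof -
      have "B (x * (E c * f)) g - B (E c * f) (x * g) =
          B ((x - s c) * (E c * f)) g - B (E c * f) ((x - s c) * g)"
        by (simp add: left_diff_distrib B_diff1 B_diff2 swap)
      also have "norm \<dots> \<le> C * norm ((x - s c) * (E c * f)) * norm g + C * norm (E c * f) * norm ((x - s c) * g)"
        by (intro norm_triangle_le_diff add_mono C(2) cfc_range_star[OF sa]) (use W E s f g in auto)
      also have "\<dots> \<le> C * (1 / real N * (1 * norm f)) * norm g + C * (1 * norm f) * (1 / real N * norm g)"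
        using C(1) normE[of c] xs[of c]
        by (intro add_mono mult_mono order_trans[OF norm_mult_ineq]) auto
      finally show ?thesis by (simp add: field_simps)
    qed
    have "B (x * f) g - B f (x * g) = (\<Sum>c\<in>{0..<4}. B (x * (E c * f)) g - B (E c * f) (x * g))"
    proof -
      have "f = (\<Sum>c\<in>{0..<4}. E c * f)" by (simp only: sum_distrib_right[symmetric] sumE mult_1)
      then have "B (x * f) g - B f (x * g) =
          B (x * (\<Sum>c\<in>{0..<4}. E c * f)) g - B (\<Sum>c\<in>{0..<4}. E c * f) (x * g)" by (simp only:)
      then show ?thesis by (simp only: sum_distrib_left B_sum1 sum_subtractf)
    qed
    also have "norm \<dots> \<le> (\<Sum>c\<in>{0..<4::int}. 2 * C * norm f * norm g / real N)"
      by (rule sum_norm_le) (rule bound)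
    finally show ?thesis by (simp add: K_def)
  qed
  have "(\<lambda>N. K / real N) \<longlonglongrightarrow> 0" by (rule lim_const_over_n)
  then have "norm (B (x * f) g - B f (x * g)) \<le> 0"
    by (rule LIMSEQ_le_const) (use main in \<open>auto intro!: exI[of _ 1]\<close>)
  then show ?thesis by (simp add: B_def)
qed

text \<open>\<open>shift_factor\<close> moves the copies of \<open>x\<close> one by one into the
  first argument, each leaving a 1 behind.\<close>

lemma replicate_selfadjoint:
  assumes n: "n \<ge> 1"
  shows "M (replicate_mset n x) = M (add_mset (x ^ n) (replicate_mset (n - 1) 1))"
proof -
  have "M (replicate_mset n x) =
      M (add_mset (x ^ Suc j) (replicate_mset j 1 + replicate_mset (n - Suc j) x))" if "j < n" for j
    using that
  proof (induction j)
    case 0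
    then obtain m where "n = Suc m" by (cases n) auto
    then show ?case by simp
  next
    case (Suc j)
    define Z where "Z = replicate_mset j 1 + replicate_mset (n - Suc (Suc j)) x"
    have 1: "n - Suc j = Suc (n - Suc (Suc j))" using Suc.prems by simp
    have "M (replicate_mset n x) = M (add_mset (x ^ Suc j) (add_mset (x * 1) Z))"
      unfolding Z_def using Suc.IH Suc.prems 1 by simp
    also have "\<dots> = M (add_mset (x * x ^ Suc j) (add_mset 1 Z))"
      by (rule shift_factor[symmetric])
        (use Suc.prems in \<open>auto simp: Z_def cfc_range_power[OF sa cfc_range_self[OF sa]] cfc_range_one[OF sa]
          cfc_range_self[OF sa] cfc_range_mult[OF sa] split: if_splits\<close>)
    finally show ?case unfolding Z_def by simp
  qed
  from this[of "n - 1"] n show ?thesis by (simp add: Suc_diff_1)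
qed

end

lemma replicate_eq_power:
  assumes n: "n \<ge> 1"
  shows "M (replicate_mset n a) = M (add_mset (a ^ n) (replicate_mset (n - 1) 1))"
proof -
  define T where "T a = M (add_mset a (replicate_mset (n - 1) 1))" for a
  obtain x y where xy: "star x = x" "star y = y" "a = x + \<i> *\<^sub>C y"
    using cartesian_decomposition by metis
  have sz: "size (replicate_mset (n - 1) (1::'a)) + 1 = n" using n by simp
  \<comment> \<open>As \<open>x\<close> and \<open>y\<close> need not commute, the coefficients are
    not binomial multiples of monomials; what matters is that they do not depend on
    \<open>c\<close>.\<close>
  have "\<exists>w. \<forall>c. (x + c *\<^sub>C y) ^ m = (\<Sum>k\<le>m. c ^ k *\<^sub>C w k)" for m
  proof (induction m)
    case 0
    show ?case by (intro exI[of _ "\<lambda>_. 1"]) simp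
  next
    case (Suc m)
    then obtain w where w: "\<And>c. (x + c *\<^sub>C y) ^ m = (\<Sum>k\<le>m. c ^ k *\<^sub>C w k)" by blast
    define u where "u k = (if k \<le> m then x * w k else 0) + (if k = 0 then 0 else y * w (k - 1))" for k
    have "(x + c *\<^sub>C y) ^ Suc m = (\<Sum>k\<le>Suc m. c ^ k *\<^sub>C u k)" for c
    proof -
      have "(x + c *\<^sub>C y) ^ Suc m = (\<Sum>k\<le>m. c ^ k *\<^sub>C (x * w k)) + (\<Sum>k\<le>m. c ^ Suc k *\<^sub>C (y * w k))"
        by (simp add: w distrib_right sum_distrib_left mult_scaleC_left mult_scaleC_right
            scaleC_scaleC complex_vector.scale_sum_right scaleC_add_right sum.distrib mult.commute)
      also have "(\<Sum>k\<le>m. c ^ k *\<^sub>C (x * w k)) = (\<Sum>k\<le>Suc m. c ^ k *\<^sub>C (if k \<le> m then x * w k else 0))"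
        by simp
      also have "(\<Sum>k\<le>m. c ^ Suc k *\<^sub>C (y * w k)) = (\<Sum>k\<le>Suc m. c ^ k *\<^sub>C (if k = 0 then 0 else y * w (k - 1)))"
        by (subst sum.atMost_Suc_shift) simp
      finally show ?thesis by (simp only: u_def scaleC_add_right sum.distrib)
    qed
    then show ?case by blast
  qed
  then obtain w where w: "\<And>c. (x + c *\<^sub>C y) ^ n = (\<Sum>k\<le>n. c ^ k *\<^sub>C w k)" by blast
  have T_sum: "T (\<Sum>k\<le>n. c ^ k *\<^sub>C w k) = (\<Sum>k\<le>n. c ^ k *\<^sub>C T (w k))" for c
    unfolding T_def by (simp only: sum[OF sz] scaleC[OF sz])
  define v where "v k = real (n choose k) *\<^sub>R M (replicate_mset k y + replicate_mset (n - k) x)" for k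
  have v: "M (replicate_mset n (x + c *\<^sub>C y)) = (\<Sum>k\<le>n. c ^ k *\<^sub>C v k)" for c
    using binomial_scaleC[of "{#}" n x c y] by (simp add: v_def)
  have "v k = T (w k)" if "k \<le> n" for k
  proof (rule polynomial_coeffs_eq[OF _ that])
    fix t :: real
    have "star (x + of_real t *\<^sub>C y) = x + of_real t *\<^sub>C y"
      by (simp add: star_add star_scaleC xy)
    from replicate_selfadjoint[OF this n]
    have "(\<Sum>k\<le>n. of_real t ^ k *\<^sub>C v k) = (\<Sum>k\<le>n. of_real t ^ k *\<^sub>C T (w k))"
      unfolding T_def[symmetric] v w T_sum .
    then show "(\<Sum>k\<le>n. t ^ k *\<^sub>R v k) = (\<Sum>k\<le>n. t ^ k *\<^sub>R T (w k))"
      by (simp only: scaleR_scaleC of_real_power)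
  qed
  \<comment> \<open>Equality of the coefficients, obtained from real \<open>c\<close>, carries over
    to \<open>c = i\<close>.\<close>
  then have "M (replicate_mset n (x + \<i> *\<^sub>C y)) = T ((x + \<i> *\<^sub>C y) ^ n)"
    unfolding v w T_sum by simp
  then show ?thesis using xy(3) by (simp add: T_def)
qed

end

section \<open>Nonnegative elements\<close>

text \<open>In the sum of the two binomial expansions the odd terms cancel and the even ones are
  nonnegative; the terms of degree 0 and 2 are kept.\<close>

lemma power_sum_ge:
  fixes u :: real
  assumes m: "m \<ge> 2"
  shows "2 + real m * (real m - 1) * u\<^sup>2 \<le> (1 + u) ^ m + (1 - u) ^ m"
proof -
  have nonneg: "0 \<le> u ^ k + (- u) ^ k" for k
    by (cases "even k") (auto simp: power_minus_odd)
  have two: "2 * (m choose 2) = m * (m - 1)"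
  proof -
    have "even (m * (m - 1))" by (cases m) auto
    then show ?thesis unfolding choose_two by (rule dvd_mult_div_cancel)
  qed
  have "(1 + u) ^ m + (1 - u) ^ m = (\<Sum>k\<le>m. real (m choose k) * (u ^ k + (- u) ^ k))"
    using binomial_ring[of u 1 m] binomial_ring[of "- u" 1 m]
    by (simp add: sum.distrib[symmetric] distrib_left add.commute)
  also have "\<dots> \<ge> (\<Sum>k\<in>{0, 2}. real (m choose k) * (u ^ k + (- u) ^ k))"
    by (rule sum_mono2) (use m nonneg in auto)
  also have "(\<Sum>k\<in>{0, 2}. real (m choose k) * (u ^ k + (- u) ^ k)) = 2 + real (2 * (m choose 2)) * u\<^sup>2"
    by simp
  also have "real (2 * (m choose 2)) = real m * (real m - 1)"
    unfolding two using m by (simp add: of_nat_diff)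
  finally show ?thesis by simp
qed

text \<open>Completing the exponent to a power of two, where the norm is exact, reverses
  submultiplicativity.\<close>

lemma norm_power_selfadjoint:
  fixes x :: "'a::unital_cstar_algebra"
  assumes "star x = x"
  shows "norm (x ^ n) = norm x ^ n"
proof (cases "x = 0")
  case True
  then show ?thesis by (cases n) auto
next
  case False
  obtain k where k: "n \<le> 2 ^ k" using less_exp[of n] less_imp_le by blast
  have "norm x ^ n * norm x ^ (2 ^ k - n) = norm (x ^ n * x ^ (2 ^ k - n))"
    using norm_power_2_power[OF assms, of k] k by (simp flip: power_add)
  also have "\<dots> \<le> norm (x ^ n) * norm x ^ (2 ^ k - n)"
    by (rule order_trans[OF norm_mult_ineq]) (intro mult_left_mono norm_power_ineq norm_ge_zero)
  finally have "norm x ^ n \<le> norm (x ^ n)" using False by simp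
  then show ?thesis using norm_power_ineq[of x n] by simp
qed

lemma norm_power_normal:
  fixes y :: "'a::unital_cstar_algebra"
  assumes "normal_element y"
  shows "norm (y ^ n) = norm y ^ n"
proof -
  have "(norm (y ^ n))\<^sup>2 = norm ((star y * y) ^ n)"
    using assms power_mult_commuting[of "star y" y n]
    by (simp add: cstar_identity[symmetric] star_power normal_element_def)
  also have "\<dots> = (norm y ^ n)\<^sup>2"
    by (subst norm_power_selfadjoint) (simp_all add: star_mult star_star cstar_identity power_mult[symmetric] mult.commute)
  finally show ?thesis by simp
qed

text \<open>
  The function \<open>t\<^sup>2 / ((1 + st)\<^sup>m + (1 - st)\<^sup>m)\<close> is at most \<open>1 / (m - 1)\<close> for \<open>s = 1/\<surd>m\<close>, whereas the
  denominator, evaluated at \<open>d\<close>, stays bounded by \<open>2 exp K\<close>.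
\<close>

lemma selfadjoint_eq_0_if_norm_flat:
  fixes d :: "'a::unital_cstar_algebra"
  assumes sa: "star d = d" and K: "K \<ge> 0"
    and flat: "\<And>s. \<bar>s\<bar> \<le> 1 \<Longrightarrow> norm (1 + s *\<^sub>R d) \<le> 1 + K * s\<^sup>2"
  shows "d = 0"
proof -
  have bound: "(norm d)\<^sup>2 \<le> 2 * exp K / real m" if m: "m \<ge> 1" for m
  proof -
    \<comment> \<open>With \<open>N = m + 1\<close> and the square of \<open>s\<close> equal to
      \<open>1 / N\<close>, the coefficient from \<open>power_sum_ge\<close> becomes exactly
      \<open>m\<close>.\<close>
    define N where "N = Suc m"
    define s where "s = 1 / sqrt (real N)"
    define D where "D t = (1 + s * t) ^ N + (1 - s * t) ^ N" for t
    have s2: "s\<^sup>2 = 1 / real N" "\<bar>s\<bar> \<le> 1" by (simp_all add: s_def power_divide N_def)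
    have Dge: "2 + real m * t\<^sup>2 \<le> D t" for t
    proof -
      have "real N * (real N - 1) * (s * t)\<^sup>2 = real m * t\<^sup>2"
        by (simp add: power_mult_distrib s2) (simp add: N_def)
      moreover have "2 \<le> N" using m by (simp add: N_def)
      ultimately show ?thesis using power_sum_ge[of N "s * t"] by (simp only: D_def)
    qed
    have Dpos: "D t > 0" for t
      using Dge[of t] by (smt (verit) of_nat_0_le_iff zero_le_mult_iff zero_le_power2)
    have cD: "continuous_on S D" for S unfolding D_def by (intro continuous_intros)
    have cg: "continuous_on S (\<lambda>t. t\<^sup>2 / D t)" for S
      by (intro continuous_intros cD) (use Dpos in \<open>auto simp: less_imp_neq[symmetric]\<close>)
    have g: "norm (cfc d (\<lambda>t. t\<^sup>2 / D t)) \<le> 1 / real m"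
    proof (rule norm_cfc_le[OF sa cg])
      fix t
      have "t\<^sup>2 * real m \<le> D t" using Dge[of t] by (simp add: mult.commute)
      then show "\<bar>t\<^sup>2 / D t\<bar> \<le> 1 / real m"
        using Dpos[of t] m by (simp add: field_simps)
    qed
    have "cfc d D = (1 + s *\<^sub>R d) ^ N + (1 + (- s) *\<^sub>R d) ^ N"
    proof -
      have "cfc d (\<lambda>t. (1 + c * t) ^ N) = (1 + c *\<^sub>R d) ^ N" for c
        by (simp add: cfc_power[OF sa] cfc_add[OF sa] cfc_one[OF sa] cfc_cmult[OF sa] cfc_ident[OF sa]
            continuous_on_add continuous_on_mult_left)
      from this[of s] this[of "- s"] show ?thesis
        unfolding D_def by (simp add: cfc_add[OF sa] continuous_intros)
    qed
    also have "norm \<dots> \<le> (1 + K / real N) ^ N + (1 + K / real N) ^ N"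
    proof (rule norm_triangle_mono)
      have "norm ((1 + c *\<^sub>R d) ^ N) \<le> (1 + K / real N) ^ N" if "c\<^sup>2 = 1 / real N" "\<bar>c\<bar> \<le> 1" for c
        by (rule order_trans[OF norm_power_ineq], rule power_mono) (use flat[OF that(2)] that(1) in auto)
      from this[of s] this[of "- s"] s2
      show "norm ((1 + s *\<^sub>R d) ^ N) \<le> (1 + K / real N) ^ N"
        "norm ((1 + (- s) *\<^sub>R d) ^ N) \<le> (1 + K / real N) ^ N" by auto
    qed
    also have "\<dots> \<le> 2 * exp K"
      using exp_ge_one_plus_x_over_n_power_n[of N K] K by (simp add: N_def)
    finally have D: "norm (cfc d D) \<le> 2 * exp K" .
    have "d * d = cfc d (\<lambda>t. t\<^sup>2 / D t * D t)"
    proof -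
      have "d * d = cfc d (\<lambda>t. t * t)" by (simp add: cfc_mult[OF sa] cfc_ident[OF sa])
      also have "(\<lambda>t. t * t) = (\<lambda>t. t\<^sup>2 / D t * D t)"
        using Dpos by (auto simp: fun_eq_iff power2_eq_square less_imp_neq[symmetric])
      finally show ?thesis .
    qed
    also have "\<dots> = cfc d (\<lambda>t. t\<^sup>2 / D t) * cfc d D" by (rule cfc_mult[OF sa cg cD])
    also have "norm \<dots> \<le> 1 / real m * (2 * exp K)"
      by (rule order_trans[OF norm_mult_ineq]) (intro mult_mono g D, auto)
    finally show ?thesis using cstar_identity[of d] by (simp add: sa)
  qed
  have "(\<lambda>m. 2 * exp K / real m) \<longlonglongrightarrow> 0" by (rule lim_const_over_n)
  then have "(norm d)\<^sup>2 \<le> 0"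
    by (rule LIMSEQ_le_const) (use bound in auto)
  then show ?thesis by simp
qed

text \<open>For \<open>v = 1 + t i b\<close>, the product \<open>star v * v\<close> agrees to first
  order with \<open>1 + t d\<close>, where \<open>d = i (b - star b)\<close> is self-adjoint. So
  flatness passes from \<open>b\<close> to \<open>d\<close> and forces \<open>d = 0\<close>.\<close>

lemma selfadjoint_if_norm_flat:
  fixes b :: "'a::unital_cstar_algebra"
  assumes K: "K \<ge> 0"
    and flat: "\<And>t. \<bar>t\<bar> \<le> 1 \<Longrightarrow> norm (1 + t *\<^sub>R (\<i> *\<^sub>C b)) \<le> 1 + K * t\<^sup>2"
  shows "star b = b"
proof -
  define d where "d = \<i> *\<^sub>C (b - star b)"
  have sd: "star d = d"
  proof -
    have "star d = - (\<i> *\<^sub>C (star b - b))"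
      by (simp add: d_def star_scaleC star_diff star_star complex_vector.scale_minus_left)
    then show ?thesis by (simp add: d_def flip: complex_vector.scale_minus_right)
  qed
  have "d = 0"
  proof (rule selfadjoint_eq_0_if_norm_flat[OF sd])
    show "0 \<le> 2 * K + K\<^sup>2 + (norm b)\<^sup>2" using K by simp
    fix t :: real assume t: "\<bar>t\<bar> \<le> 1"
    define v where "v = 1 + t *\<^sub>R (\<i> *\<^sub>C b)"
    have "1 + t *\<^sub>R d = star v * v - t\<^sup>2 *\<^sub>R (star b * b)"
      by (simp add: v_def d_def star_add star_scaleR star_scaleC algebra_simps mult_scaleC_left mult_scaleC_right
          scaleC_scaleR scaleC_scaleC complex_vector.scale_right_diff_distrib complex_vector.scale_minus_left power2_eq_square)
    also have "norm \<dots> \<le> (norm v)\<^sup>2 + t\<^sup>2 * (norm b)\<^sup>2"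
      by (rule order_trans[OF norm_triangle_ineq4]) (simp add: cstar_identity)
    also have "\<dots> \<le> (1 + K * t\<^sup>2)\<^sup>2 + t\<^sup>2 * (norm b)\<^sup>2"
      using flat[OF t] by (intro add_right_mono power_mono) (auto simp: v_def)
    also have "\<dots> \<le> 1 + (2 * K + K\<^sup>2 + (norm b)\<^sup>2) * t\<^sup>2"
    proof -
      have "K\<^sup>2 * (t\<^sup>2 * t\<^sup>2) \<le> K\<^sup>2 * (t\<^sup>2 * 1)"
        using t by (intro mult_left_mono) (auto simp: abs_square_le_1)
      then show ?thesis by (simp add: power2_eq_square algebra_simps)
    qed
    finally show "norm (1 + t *\<^sub>R d) \<le> 1 + (2 * K + K\<^sup>2 + (norm b)\<^sup>2) * t\<^sup>2" .
  qed
  then have "\<i> *\<^sub>C \<i> *\<^sub>C (b - star b) = 0" by (simp add: d_def)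
  then show ?thesis by (simp add: scaleC_scaleC scaleC_minus1)
qed

section \<open>Positivity expressed through the norm\<close>

text \<open>For self-adjoint \<open>p\<close> the inequality says that the spectrum lies between 0
  and \<open>2 * r\<close>. In this form positivity passes at once to sums and to images under
  unital contractions that preserve self-adjointness.\<close>

definition nonneg_element :: "'a::unital_cstar_algebra \<Rightarrow> bool"
  where "nonneg_element p \<longleftrightarrow> star p = p \<and> (\<exists>r. norm (r *\<^sub>R 1 - p) \<le> r)"

lemma nonneg_element_cfc:
  fixes x :: "'a::unital_cstar_algebra"
  assumes sa: "star x = x" and f: "continuous_on (cfc_domain x) f"
    and nonneg: "\<And>t. \<bar>t\<bar> \<le> norm x \<Longrightarrow> 0 \<le> f t"
  shows "nonneg_element (cfc x f)"
proof -
  obtain r where r: "\<And>t. t \<in> cfc_domain x \<Longrightarrow> \<bar>f t\<bar> \<le> r"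
    using cfc_domain_bounded[OF f] unfolding bounded_real by (metis imageI)
  have "norm (cfc x (\<lambda>t. r - f t)) \<le> r"
  proof (rule norm_cfc_le[OF sa])
    show "\<bar>r - f t\<bar> \<le> r" if "\<bar>t\<bar> \<le> norm x" for t
      using r[of t] nonneg[OF that] that by (auto simp: abs_le_iff)
  qed (intro continuous_intros f)
  then have "norm (r *\<^sub>R 1 - cfc x f) \<le> r"
    using f by (simp add: cfc_diff[OF sa] cfc_const[OF sa])
  then show ?thesis using star_cfc[OF sa f] by (auto simp: nonneg_element_def)
qed

lemma nonneg_element_square: "star x = x \<Longrightarrow> nonneg_element (x * x)"
  using nonneg_element_cfc[of x "\<lambda>t. t * t"] by (simp add: cfc_mult cfc_ident continuous_on_mult)

lemma nonneg_element_add: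
  assumes "nonneg_element p" "nonneg_element q"
  shows "nonneg_element (p + q)"
proof -
  obtain r s where "norm (r *\<^sub>R 1 - p) \<le> r" "norm (s *\<^sub>R 1 - q) \<le> s"
    using assms by (auto simp: nonneg_element_def)
  then have "norm ((r *\<^sub>R 1 - p) + (s *\<^sub>R 1 - q)) \<le> r + s" by (rule norm_triangle_mono)
  then have "norm ((r + s) *\<^sub>R 1 - (p + q)) \<le> r + s" by (simp add: algebra_simps)
  then show ?thesis using assms by (auto simp: nonneg_element_def star_add)
qed

lemma nonneg_element_0: "nonneg_element (0::'a::unital_cstar_algebra)"
  by (auto simp: nonneg_element_def intro: exI[of _ 0])

lemma nonneg_element_sum:
  "(\<And>i. i \<in> I \<Longrightarrow> nonneg_element (f i)) \<Longrightarrow> nonneg_element (\<Sum>i\<in>I. f i)"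
  by (induction I rule: infinite_finite_induct) (auto simp: nonneg_element_0 nonneg_element_add)

text \<open>The witness \<open>r\<close> makes \<open>z = 1 - p / r\<close> an element of norm at
  most 1, so \<open>sqrt (1 - t)\<close> squares to \<open>1 - t\<close> on all of its
  domain.\<close>

lemma nonneg_element_sqrt:
  fixes p :: "'a::unital_cstar_algebra"
  assumes "nonneg_element p"
  obtains q where "star q = q" "p = q * q"
proof -
  obtain r where r: "norm (r *\<^sub>R 1 - p) \<le> r" and sp: "star p = p"
    using assms by (auto simp: nonneg_element_def)
  show thesis
  proof (cases "r = 0")
    case True
    then show thesis using r that[of 0] by simp
  next
    case False
    then have r0: "r > 0" using r by (smt (verit) norm_ge_zero)
    define z where "z = 1 - (1/r) *\<^sub>R p"
    have sz: "star z = z" by (simp add: z_def star_diff star_scaleR sp)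
    have "z = (1/r) *\<^sub>R (r *\<^sub>R 1 - p)" using r0 by (simp add: z_def algebra_simps)
    then have "norm z = norm (r *\<^sub>R 1 - p) / r" using r0 by simp
    then have nz: "norm z \<le> 1" using r r0 by (simp add: divide_le_eq_1)
    have c: "continuous_on S (\<lambda>t. sqrt (1 - t))" for S by (intro continuous_intros)
    have "cfc z (\<lambda>t. sqrt (1 - t)) * cfc z (\<lambda>t. sqrt (1 - t)) = cfc z (\<lambda>t. sqrt (1 - t) * sqrt (1 - t))"
      by (rule cfc_mult[OF sz c c, symmetric])
    also have "\<dots> = cfc z (\<lambda>t. 1 - t)"
      by (rule cfc_cong[OF sz]) (use nz in \<open>auto intro!: continuous_intros\<close>)
    also have "\<dots> = (1/r) *\<^sub>R p"
      by (simp add: cfc_diff[OF sz] cfc_one[OF sz] cfc_ident[OF sz]) (simp add: z_def)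
    finally have "p = (sqrt r *\<^sub>R cfc z (\<lambda>t. sqrt (1 - t))) * (sqrt r *\<^sub>R cfc z (\<lambda>t. sqrt (1 - t)))"
      using r0 by simp
    then show thesis by (rule that[rotated]) (simp add: star_scaleR star_cfc[OF sz c])
  qed
qed

text \<open>Writing \<open>p\<close> as a square reduces this to a scalar bound for
  \<open>r - t * t\<close>. It frees the choice of witness: \<open>norm p\<close> depends
  continuously on \<open>p\<close>, as \<open>nonneg_element_limit\<close> requires.\<close>

lemma nonneg_element_norm_diff:
  fixes p :: "'a::unital_cstar_algebra"
  assumes "nonneg_element p" "norm p \<le> r"
  shows "norm (r *\<^sub>R 1 - p) \<le> r"
proof -
  obtain q where q: "star q = q" "p = q * q" using nonneg_element_sqrt[OF assms(1)] .
  have n: "(norm q)\<^sup>2 \<le> r" using assms(2) cstar_identity[of q] by (simp add: q)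
  have "norm (cfc q (\<lambda>t. r - t * t)) \<le> r"
  proof (rule norm_cfc_le[OF q(1)])
    fix t assume "\<bar>t\<bar> \<le> norm q"
    then have "t * t \<le> (norm q)\<^sup>2" using power_mono[of "\<bar>t\<bar>" "norm q" 2] by (simp add: power2_eq_square)
    then show "\<bar>r - t * t\<bar> \<le> r" using n by (simp add: abs_le_iff)
  qed (intro continuous_intros)
  then show ?thesis
    by (simp add: cfc_diff cfc_mult cfc_const cfc_ident continuous_on_mult q)
qed

lemma nonneg_element_limit:
  fixes p :: "nat \<Rightarrow> 'a::unital_cstar_algebra"
  assumes p: "\<And>n. nonneg_element (p n)" and lim: "p \<longlonglongrightarrow> l"
  shows "nonneg_element l"
proof -
  have "star l = l"
    using bounded_linear.tendsto[OF bounded_linear_star lim] lim LIMSEQ_unique p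
    by (auto simp: nonneg_element_def)
  moreover have "norm (norm l *\<^sub>R 1 - l) \<le> norm l"
  proof (rule LIMSEQ_le)
    show "(\<lambda>n. norm (norm (p n) *\<^sub>R 1 - p n)) \<longlonglongrightarrow> norm (norm l *\<^sub>R 1 - l)"
      by (intro tendsto_intros lim)
    show "(\<lambda>n. norm (p n)) \<longlonglongrightarrow> norm l" by (intro tendsto_intros lim)
    show "\<exists>N. \<forall>n\<ge>N. norm (norm (p n) *\<^sub>R 1 - p n) \<le> norm (p n)"
      using nonneg_element_norm_diff[OF p] by blast
  qed
  ultimately show ?thesis by (auto simp: nonneg_element_def)
qed

text \<open>For the normalized \<open>d\<close>, both \<open>1 + d\<close> and \<open>1 - d\<close>
  have norm at most 1. Convexity extends this to \<open>1 + s d\<close> for \<open>s\<close> between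
  -1 and 1, which is flatness with constant 0.\<close>

lemma nonneg_element_antisym:
  fixes p :: "'a::unital_cstar_algebra"
  assumes p: "nonneg_element p" and m: "nonneg_element (- p)"
  shows "p = 0"
proof (rule ccontr)
  assume p0: "p \<noteq> 0"
  define d where "d = (1 / norm p) *\<^sub>R p"
  have sd: "star d = d" using p by (simp add: d_def star_scaleR nonneg_element_def)
  have eq: "1 + c *\<^sub>R d = (1 / norm p) *\<^sub>R (norm p *\<^sub>R 1 + c *\<^sub>R p)" for c
    using p0 by (simp add: d_def scaleR_add_right)
  have up: "norm (1 + 1 *\<^sub>R d) \<le> 1" "norm (1 + (-1) *\<^sub>R d) \<le> 1"
    unfolding eq using nonneg_element_norm_diff[OF m, of "norm p"] nonneg_element_norm_diff[OF p, of "norm p"] p0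
    by (simp_all add: divide_le_eq_1)
  have "norm (1 + s *\<^sub>R d) \<le> 1 + 0 * s\<^sup>2" if "\<bar>s\<bar> \<le> 1" for s
  proof -
    have "a *\<^sub>R (1 + 1 *\<^sub>R d) + b *\<^sub>R (1 + (-1) *\<^sub>R d) = (a + b) *\<^sub>R 1 + (a - b) *\<^sub>R d" for a b
      by (simp add: algebra_simps)
    from this[of "(1 + s) / 2" "(1 - s) / 2"]
    have "1 + s *\<^sub>R d = ((1 + s) / 2) *\<^sub>R (1 + 1 *\<^sub>R d) + ((1 - s) / 2) *\<^sub>R (1 + (-1) *\<^sub>R d)"
      by (simp add: field_simps)
    also have "norm \<dots> \<le> (1 + s) / 2 * 1 + (1 - s) / 2 * 1"
      using that up by (intro norm_triangle_mono) (auto simp: abs_le_iff intro!: mult_left_le)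
    finally show ?thesis by (simp add: field_simps)
  qed
  then have "d = 0" by (intro selfadjoint_eq_0_if_norm_flat[OF sd order_refl])
  then show False using p0 by (simp add: d_def)
qed

text \<open>
  \<open>(r + y y\<^sup>*)\<^sup>m = r\<^sup>m + y S y\<^sup>*\<close> where \<open>S\<close> has norm at most \<open>m r\<^sup>m\<^sup>-\<^sup>1\<close>, because \<open>r + y\<^sup>* y = r - k\<close> has
  norm at most \<open>r\<close>. As \<open>m\<close> grows this gives \<open>\<parallel>r + y y\<^sup>*\<parallel> \<le> r\<close>, that is \<open>y y\<^sup>* \<le> 0\<close>, whereas
  \<open>y\<^sup>* y + y y\<^sup>*\<close> is a sum of squares of self-adjoint elements.
\<close>

lemma star_mult_nonpos_imp_0:
  fixes y :: "'a::unital_cstar_algebra"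
  assumes k: "nonneg_element k" "star y * y = - k"
  shows "y = 0"
proof -
  \<comment> \<open>The summand 1 keeps \<open>r\<close> positive even for \<open>k = 0\<close>,
    because the final estimate divides by \<open>r\<close>.\<close>
  define r where "r = norm k + 1"
  have r: "r > 0" "norm (r *\<^sub>R 1 - k) \<le> r"
    unfolding r_def using nonneg_element_norm_diff[OF k(1)] by (auto intro: add_nonneg_pos)
  define v where "v = r *\<^sub>R 1 + y * star y"
  have sv: "star v = v" by (simp add: v_def star_add star_scaleR star_mult star_star)
  have "\<exists>S. v ^ m = r ^ m *\<^sub>R 1 + y * S * star y \<and> norm S * r \<le> real m * r ^ m" for m
  proof (induction m)
    case 0
    show ?case by (intro exI[of _ 0]) simp
  next
    case (Suc m)
    then obtain S where S: "v ^ m = r ^ m *\<^sub>R 1 + y * S * star y" "norm S * r \<le> real m * r ^ m" by blast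
    \<comment> \<open>Multiplying \<open>y * S * star y\<close> by \<open>y * star y\<close> from
      the left places \<open>star y * y = - k\<close> in front of \<open>S\<close>.\<close>
    define S' where "S' = r ^ m *\<^sub>R 1 + (r *\<^sub>R 1 - k) * S"
    have kk: "y * (star y * y) * S * star y = - (y * k * S * star y)" by (simp add: k(2))
    have "v ^ Suc m = r ^ Suc m *\<^sub>R 1 + y * S' * star y"
      unfolding power_Suc S(1) using kk
      by (simp add: v_def S'_def algebra_simps)
    moreover have "norm S' * r \<le> real (Suc m) * r ^ Suc m"
    proof -
      have "norm S' \<le> r ^ m + r * norm S"
        unfolding S'_def
      proof (rule norm_triangle_mono)
        show "norm ((r *\<^sub>R 1 - k) * S) \<le> r * norm S"
          by (rule order_trans[OF norm_mult_ineq]) (intro mult_right_mono r norm_ge_zero)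
      qed (use r in simp)
      then have "norm S' * r \<le> (r ^ m + r * norm S) * r" using r by (intro mult_right_mono) auto
      also have "\<dots> = r ^ Suc m + r * (norm S * r)" by (simp add: algebra_simps)
      also have "\<dots> \<le> r ^ Suc m + r * (real m * r ^ m)" using S(2) r by (intro add_left_mono mult_left_mono) auto
      finally show ?thesis by (simp add: algebra_simps)
    qed
    ultimately show ?case by blast
  qed
  then have S: "\<exists>S. v ^ m = r ^ m *\<^sub>R 1 + y * S * star y \<and> norm S * r \<le> real m * r ^ m" for m .
  have "norm v \<le> r"
  proof (rule le_of_power_le_linear)
    fix j
    obtain S where S: "v ^ 2 ^ j = r ^ 2 ^ j *\<^sub>R 1 + y * S * star y" "norm S * r \<le> real (2 ^ j) * r ^ 2 ^ j"
      using S[of "2 ^ j"] by blast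
    have "norm v ^ 2 ^ j = norm (v ^ 2 ^ j)" by (simp add: norm_power_2_power[OF sv])
    also have "\<dots> \<le> r ^ 2 ^ j + norm (y * S * star y)"
      unfolding S(1) by (rule order_trans[OF norm_triangle_ineq]) (use r in simp)
    also have "norm (y * S * star y) \<le> norm (y * S) * norm y"
      using norm_mult_ineq[of "y * S" "star y"] by simp
    also have "\<dots> \<le> norm y * norm S * norm y"
      by (intro mult_right_mono norm_mult_ineq) simp
    also have "\<dots> = (norm y)\<^sup>2 / r * (norm S * r)" using r by (simp add: power2_eq_square)
    also have "\<dots> \<le> (norm y)\<^sup>2 / r * (real (2 ^ j) * r ^ 2 ^ j)"
      using S(2) r by (intro mult_left_mono) auto
    finally show "norm v ^ 2 ^ j \<le> ((norm y)\<^sup>2 / r * 2 ^ j + 1) * r ^ 2 ^ j"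
      by (simp add: algebra_simps)
  qed (use r in simp)
  \<comment> \<open>The bound on \<open>norm v\<close> makes \<open>r\<close> a positivity witness
    for \<open>- (y * star y)\<close>.\<close>
  then have neg: "nonneg_element (- (y * star y))"
    by (auto simp: nonneg_element_def star_minus star_mult star_star v_def intro: exI[of _ r])
  obtain a b where ab: "star a = a" "star b = b" "y = a + \<i> *\<^sub>C b"
    using cartesian_decomposition by metis
  have sy: "star y = a - \<i> *\<^sub>C b"
    by (simp add: ab star_add star_scaleC complex_vector.scale_minus_left)
  have "star y * y + y * star y = (a * a + b * b) + (a * a + b * b)"
    unfolding sy unfolding ab(3)
    by (simp add: algebra_simps mult_scaleC_left mult_scaleC_right scaleC_scaleC scaleC_minus1)
  then have "nonneg_element (star y * y + y * star y)"
    using ab by (simp add: nonneg_element_add nonneg_element_square)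
  moreover have "nonneg_element (- (star y * y + y * star y))"
    using nonneg_element_add[OF k(1) neg] by (simp add: k(2))
  ultimately have "star y * y + y * star y = 0" by (rule nonneg_element_antisym)
  then have "y * star y = k" by (simp add: k(2))
  then have "k = 0" using neg k(1) nonneg_element_antisym by auto
  then show ?thesis using cstar_identity[of y] by (simp add: k(2))
qed

text \<open>Let \<open>b\<close> be the negative part of \<open>a = star y * y\<close>. Then
  \<open>y * b\<close> meets \<open>star_mult_nonpos_imp_0\<close> with \<open>k = b ^ 3\<close> and
  vanishes, so \<open>a * b = 0\<close>; as \<open>a * b\<close> is also \<open>- (b * b)\<close>,
  the negative part is 0.\<close>

lemma nonneg_element_star_mult_self:
  fixes y :: "'a::unital_cstar_algebra"
  shows "nonneg_element (star y * y)"
proof -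
  define a where "a = star y * y"
  have sa: "star a = a" by (simp add: a_def star_mult star_star)
  define g where "g t = max 0 (- t)" for t :: real
  have cg: "continuous_on S g" for S unfolding g_def by (intro continuous_intros)
  define b where "b = cfc a g"
  have sb: "star b = b" unfolding b_def by (rule star_cfc[OF sa cg])
  have b3: "cfc a (\<lambda>t. g t ^ 3) = b ^ 3" unfolding b_def by (rule cfc_power[OF sa cg])
  have "y * b = 0"
  proof (rule star_mult_nonpos_imp_0)
    show "nonneg_element (cfc a (\<lambda>t. g t ^ 3))"
      by (rule nonneg_element_cfc[OF sa]) (auto simp: g_def intro!: continuous_intros)
    have "star (y * b) * (y * b) = b * a * b" by (simp add: star_mult sb a_def mult.assoc)
    also have "\<dots> = cfc a (\<lambda>t. g t * t * g t)"
      by (simp add: b_def cfc_mult[OF sa] cfc_ident[OF sa] cg continuous_on_mult)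
    also have "(\<lambda>t. g t * t * g t) = (\<lambda>t. (-1) * g t ^ 3)"
      by (auto simp: fun_eq_iff g_def max_def power3_eq_cube)
    also have "cfc a \<dots> = - cfc a (\<lambda>t. g t ^ 3)"
      by (subst cfc_cmult[OF sa]) (auto intro!: continuous_intros cg)
    finally show "star (y * b) * (y * b) = - cfc a (\<lambda>t. g t ^ 3)" .
  qed
  then have "star y * y * b = 0" by (simp add: mult.assoc)
  then have "a * b = 0" by (simp add: a_def)
  then have "cfc a (\<lambda>t. t * g t) = 0" by (simp add: b_def cfc_mult[OF sa] cfc_ident[OF sa] cg)
  also have "(\<lambda>t. t * g t) = (\<lambda>t. (-1) * (g t * g t))"
    by (auto simp: fun_eq_iff g_def max_def)
  finally have "b * b = 0"
    using cfc_cmult[OF sa continuous_on_mult[OF cg cg], of "-1"] cfc_mult[OF sa cg cg] by (simp add: b_def)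
  then have "b = 0" using cstar_identity[of b] by (simp add: sb)
  have "cfc a (\<lambda>t. t + g t) = a + b"
    by (simp add: cfc_add[OF sa] cg cfc_ident[OF sa] b_def)
  moreover have "nonneg_element (cfc a (\<lambda>t. t + g t))"
    by (rule nonneg_element_cfc[OF sa]) (auto simp: g_def intro!: continuous_intros)
  ultimately show ?thesis using \<open>b = 0\<close> by (simp add: a_def)
qed

text \<open>The product equals \<open>star (q * c) * (q * c)\<close> for a root \<open>q\<close> of
  \<open>p\<close>. As \<open>q * c\<close> need not be self-adjoint, positivity of squares of
  self-adjoint elements would not be enough.\<close>

lemma nonneg_element_conjugate:
  fixes p :: "'a::unital_cstar_algebra"
  assumes p: "nonneg_element p" and c: "star c = c"
  shows "nonneg_element (c * p * c)"
proof -
  obtain q where q: "star q = q" "p = q * q" using nonneg_element_sqrt[OF p] .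
  then have "c * p * c = star (q * c) * (q * c)" by (simp add: star_mult c mult.assoc)
  then show ?thesis by (simp only: nonneg_element_star_mult_self)
qed

text \<open>
  With \<open>p\<^sub>i = R(e\<^sub>i)\<close> for a partition of unity \<open>e\<^sub>i\<close> and \<open>w = \<Sum> \<beta>\<^sub>i p\<^sub>i\<close>, Kadison's inequality is the
  limit of \<open>0 \<le> \<Sum> (\<beta>\<^sub>i - w) p\<^sub>i (\<beta>\<^sub>i - w) = \<Sum> \<beta>\<^sub>i\<^sup>2 p\<^sub>i - w\<^sup>2\<close>.
\<close>

lemma Kadison_inequality:
  fixes R :: "'a::unital_cstar_algebra \<Rightarrow> 'b::unital_cstar_algebra"
  assumes lin: "linear R" and one: "R 1 = 1"
    and sR: "\<And>x. star x = x \<Longrightarrow> star (R x) = R x"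
    and contr: "\<And>x. star x = x \<Longrightarrow> norm (R x) \<le> norm x"
    and sa: "star x = x"
  shows "nonneg_element (R (x * x) - R x * R x)"
proof -
  have pos: "nonneg_element (R p)" if p: "nonneg_element p" for p
  proof -
    obtain r where r: "norm (r *\<^sub>R 1 - p) \<le> r" and sp: "star p = p"
      using p by (auto simp: nonneg_element_def)
    have "norm (r *\<^sub>R 1 - R p) = norm (R (r *\<^sub>R 1 - p))"
      by (simp add: linear_diff[OF lin] linear_scale[OF lin] one)
    also have "\<dots> \<le> r" using contr[of "r *\<^sub>R 1 - p"] r by (simp add: star_diff star_scaleR sp)
    finally show ?thesis using sR[OF sp] by (auto simp: nonneg_element_def)
  qed
  \<comment> \<open>\<open>v\<close> and \<open>u\<close> interpolate \<open>t\<close> and its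
    square at the same nodes \<open>i / N\<close> by the same hats, so their images are the first
    and second moments of one family \<open>p i\<close>.\<close>
  have approx: "\<exists>v u. star v = v \<and> star u = u \<and> nonneg_element (R u - R v * R v) \<and>
      norm (x - v) \<le> 1 / real N \<and> norm (x * x - u) \<le> (2 * norm x + 1) / real N" if N: "N \<ge> 1" for N
  proof -
    define L where "L = nat \<lceil>real N * norm x\<rceil>"
    define I where "I = {- int L..int L}"
    define e where "e i t = hat (real N * t - of_int i)" for i :: int and t
    define \<beta> where "\<beta> i = of_int i / real N" for i :: int
    have ce: "continuous_on S (e i)" for S i unfolding e_def by (intro continuous_intros)
    have e0: "0 \<le> e i t" for i t by (simp add: e_def hat_nonneg)
    have sum1: "(\<Sum>i\<in>I. e i t) = 1" if "\<bar>t\<bar> \<le> norm x" for t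
      unfolding I_def e_def
    proof (rule sum_hat)
      have "\<bar>real N * t\<bar> \<le> real N * norm x" using that by (simp add: abs_mult mult_left_mono)
      then show "\<bar>real N * t\<bar> \<le> real L" unfolding L_def by linarith
    qed
    have supp: "\<bar>t - \<beta> i\<bar> \<le> 1 / real N" if "e i t \<noteq> 0" for i t
    proof -
      have "\<bar>real N * t - of_int i\<bar> < 1" using that unfolding e_def by (rule hat_nonzero)
      moreover have "t - \<beta> i = (real N * t - of_int i) / real N" using N by (simp add: \<beta>_def field_simps)
      ultimately show ?thesis using N by (simp add: abs_divide divide_right_mono)
    qed
    define E where "E i = cfc x (e i)" for i
    define v where "v = (\<Sum>i\<in>I. \<beta> i *\<^sub>R E i)"
    define u where "u = (\<Sum>i\<in>I. (\<beta> i)\<^sup>2 *\<^sub>R E i)"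
    have sE: "star (E i) = E i" for i unfolding E_def by (rule star_cfc[OF sa ce])
    have sv: "star v = v" and su: "star u = u" by (simp_all add: v_def u_def star_sum star_scaleR sE)
    have combo: "cfc x (\<lambda>t. \<Sum>i\<in>I. c i * e i t) = (\<Sum>i\<in>I. c i *\<^sub>R E i)" for c
      by (subst cfc_sum[OF sa]) (auto simp: E_def cfc_cmult[OF sa ce] intro!: continuous_intros ce)
    have "(\<Sum>i\<in>I. E i) = cfc x (\<lambda>t. \<Sum>i\<in>I. e i t)" using combo[of "\<lambda>_. 1"] by simp
    also have "\<dots> = cfc x (\<lambda>_. 1)" by (rule cfc_cong[OF sa]) (auto simp: sum1)
    finally have sumE: "(\<Sum>i\<in>I. E i) = 1" by (simp add: cfc_one[OF sa])
    define p where "p i = R (E i)" for i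
    define w where "w = R v"
    have pp: "nonneg_element (p i)" for i
      unfolding p_def E_def by (intro pos nonneg_element_cfc[OF sa ce] e0)
    have sw: "star w = w" unfolding w_def by (rule sR[OF sv])
    have w: "(\<Sum>i\<in>I. \<beta> i *\<^sub>R p i) = w"
      by (simp add: w_def v_def p_def linear_sum[OF lin] linear_scale[OF lin])
    have Ru: "(\<Sum>i\<in>I. (\<beta> i)\<^sup>2 *\<^sub>R p i) = R u"
      by (simp add: u_def p_def linear_sum[OF lin] linear_scale[OF lin])
    have sump: "(\<Sum>i\<in>I. p i) = 1"
      unfolding p_def linear_sum[OF lin, symmetric] sumE one ..
    have "(\<beta> i *\<^sub>R 1 - w) * p i * (\<beta> i *\<^sub>R 1 - w) =
        (\<beta> i)\<^sup>2 *\<^sub>R p i - (\<beta> i *\<^sub>R p i) * w - w * (\<beta> i *\<^sub>R p i) + w * p i * w" for i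
      by (simp add: algebra_simps power2_eq_square)
    then have "(\<Sum>i\<in>I. (\<beta> i *\<^sub>R 1 - w) * p i * (\<beta> i *\<^sub>R 1 - w)) =
        R u - w * w - w * w + w * 1 * w"
      unfolding Ru[symmetric]
      by (simp only: sum.distrib sum_subtractf sum_distrib_left[symmetric] sum_distrib_right[symmetric] w sump)
    moreover have "nonneg_element (\<Sum>i\<in>I. (\<beta> i *\<^sub>R 1 - w) * p i * (\<beta> i *\<^sub>R 1 - w))"
      by (intro nonneg_element_sum nonneg_element_conjugate pp) (simp add: star_diff star_scaleR sw)
    ultimately have "nonneg_element (R u - R v * R v)" by (simp add: w_def)
    moreover have "norm (x - v) \<le> 1 / real N"
    proof -
      have "x - v = cfc x (\<lambda>t. t - (\<Sum>i\<in>I. \<beta> i * e i t))"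
        unfolding v_def combo[symmetric]
        by (subst cfc_diff[OF sa]) (auto simp: cfc_ident[OF sa] intro!: continuous_intros ce)
      also have "norm \<dots> \<le> 1 / real N"
      proof (rule norm_cfc_le[OF sa])
        fix t assume t: "\<bar>t\<bar> \<le> norm x"
        have term_le: "\<bar>(t - \<beta> i) * e i t\<bar> \<le> 1 / real N * e i t" for i
        proof (cases "e i t = 0")
          case False
          from mult_right_mono[OF supp[OF False] e0[of i t]] show ?thesis
            using e0[of i t] by (simp only: abs_mult abs_of_nonneg)
        qed simp
        have "t - (\<Sum>i\<in>I. \<beta> i * e i t) = (\<Sum>i\<in>I. (t - \<beta> i) * e i t)"
          using sum1[OF t] by (simp add: left_diff_distrib sum_subtractf flip: sum_distrib_left)
        also have "\<bar>\<dots>\<bar> \<le> (\<Sum>i\<in>I. 1 / real N * e i t)"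
          by (rule order_trans[OF sum_abs sum_mono]) (rule term_le)
        also have "\<dots> = 1 / real N" using sum1[OF t] by (simp flip: sum_divide_distrib)
        finally show "\<bar>t - (\<Sum>i\<in>I. \<beta> i * e i t)\<bar> \<le> 1 / real N" .
      qed (intro continuous_intros ce)
      finally show ?thesis .
    qed
    moreover have "norm (x * x - u) \<le> (2 * norm x + 1) / real N"
    proof -
      have "x * x - u = cfc x (\<lambda>t. t * t - (\<Sum>i\<in>I. (\<beta> i)\<^sup>2 * e i t))"
        unfolding u_def combo[symmetric]
        by (subst cfc_diff[OF sa]) (auto simp: cfc_ident[OF sa] cfc_mult[OF sa] intro!: continuous_intros ce)
      also have "norm \<dots> \<le> (2 * norm x + 1) / real N"
      proof (rule norm_cfc_le[OF sa])
        fix t assume t: "\<bar>t\<bar> \<le> norm x"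
        have "\<bar>(t * t - (\<beta> i)\<^sup>2) * e i t\<bar> \<le> (2 * norm x + 1) / real N * e i t" for i
        proof (cases "e i t = 0")
          case False
          have s: "\<bar>t - \<beta> i\<bar> \<le> 1 / real N" by (rule supp[OF False])
          moreover have "1 / real N \<le> 1" using N by simp
          ultimately have "\<bar>t + \<beta> i\<bar> \<le> 2 * norm x + 1" using t by linarith
          then have "\<bar>t - \<beta> i\<bar> * \<bar>t + \<beta> i\<bar> \<le> 1 / real N * (2 * norm x + 1)"
            using s by (intro mult_mono) auto
          moreover have "t * t - (\<beta> i)\<^sup>2 = (t - \<beta> i) * (t + \<beta> i)"
            by (simp add: algebra_simps power2_eq_square)
          ultimately have "\<bar>t * t - (\<beta> i)\<^sup>2\<bar> \<le> (2 * norm x + 1) / real N" by (simp add: abs_mult)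
          from mult_right_mono[OF this e0[of i t]] show ?thesis
            using e0[of i t] by (simp only: abs_mult abs_of_nonneg)
        qed simp
        then have le: "\<bar>\<Sum>i\<in>I. (t * t - (\<beta> i)\<^sup>2) * e i t\<bar> \<le> (\<Sum>i\<in>I. (2 * norm x + 1) / real N * e i t)"
          by (intro order_trans[OF sum_abs sum_mono])
        have "t * t - (\<Sum>i\<in>I. (\<beta> i)\<^sup>2 * e i t) = (\<Sum>i\<in>I. (t * t - (\<beta> i)\<^sup>2) * e i t)"
          using sum1[OF t] by (simp add: left_diff_distrib sum_subtractf flip: sum_distrib_left)
        also note le
        also have "(\<Sum>i\<in>I. (2 * norm x + 1) / real N * e i t) = (2 * norm x + 1) / real N"
          unfolding sum_distrib_left[symmetric] sum1[OF t] by simp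
        finally show "\<bar>t * t - (\<Sum>i\<in>I. (\<beta> i)\<^sup>2 * e i t)\<bar> \<le> (2 * norm x + 1) / real N" .
      qed (intro continuous_intros ce)
      finally show ?thesis .
    qed
    ultimately show ?thesis using sv su by blast
  qed
  have "\<forall>N. \<exists>v u. star v = v \<and> star u = u \<and> nonneg_element (R u - R v * R v) \<and>
      norm (x - v) \<le> 1 / real (Suc N) \<and> norm (x * x - u) \<le> (2 * norm x + 1) / real (Suc N)"
    by (intro allI approx) simp
  then obtain v u where vu: "\<And>N. star (v N) = v N" "\<And>N. star (u N) = u N"
      "\<And>N. nonneg_element (R (u N) - R (v N) * R (v N))"
      "\<And>N. norm (x - v N) \<le> 1 / real (Suc N)"
      "\<And>N. norm (x * x - u N) \<le> (2 * norm x + 1) / real (Suc N)"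
    by metis
  \<comment> \<open>\<open>contr\<close> concerns self-adjoint elements, so continuity of
    \<open>R\<close> is used along self-adjoint sequences.\<close>
  have lim: "(\<lambda>N. R (q N)) \<longlonglongrightarrow> R l"
    if q: "\<And>N. star (q N) = q N" "star l = l" "\<And>N. norm (l - q N) \<le> c / real (Suc N)" for q l c
  proof (rule Lim_null_comparison[THEN LIM_zero_cancel])
    have "norm (R (q N) - R l) \<le> c / real (Suc N)" for N
      using contr[of "q N - l"] q(1)[of N] q(2) q(3)[of N]
      by (simp add: linear_diff[OF lin] star_diff norm_minus_commute)
    then show "\<forall>\<^sub>F N in sequentially. norm (R (q N) - R l) \<le> c / real (Suc N)" by simp
    show "(\<lambda>N. c / real (Suc N)) \<longlonglongrightarrow> 0"
      using LIMSEQ_Suc[OF lim_const_over_n] .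
  qed
  have "(\<lambda>N. R (u N) - R (v N) * R (v N)) \<longlonglongrightarrow> R (x * x) - R x * R x"
    by (intro tendsto_intros lim[OF vu(1) sa vu(4)] lim[OF vu(2) _ vu(5)]) (simp add: star_mult sa)
  then show ?thesis by (rule nonneg_element_limit[OF vu(3)])
qed

section \<open>Jordan isomorphisms\<close>

lemma orthogonal_power_add:
  fixes a b :: "'a::ring_1"
  assumes "a * b = 0" "b * a = 0" "n \<ge> 1"
  shows "(a + b) ^ n = a ^ n + b ^ n"
  using assms(3)
proof (induction n rule: dec_induct)
  case (step m)
  then obtain k where "m = Suc k" by (cases m) auto
  then have "a * b ^ m = 0" "b * a ^ m = 0" using assms by (simp_all flip: mult.assoc)
  then show ?case using step by (simp add: algebra_simps)
qed simp

lemma power_scaleC: "(c *\<^sub>C x) ^ k = c ^ k *\<^sub>C (x::'a::unital_cstar_algebra) ^ k"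
  by (induction k) (simp_all add: mult_scaleC_left mult_scaleC_right scaleC_scaleC mult.commute)

text \<open>The roots \<open>a\<close> and \<open>b\<close> of the positive and negative parts are
  orthogonal, so \<open>a + w b\<close> with \<open>w ^ n = -1\<close> has the right power. It is
  normal but in general not self-adjoint.\<close>

lemma selfadjoint_normal_root:
  fixes x :: "'a::unital_cstar_algebra"
  assumes sa: "star x = x" and n: "n \<ge> 1"
  obtains y where "normal_element y" "y ^ n = x"
proof -
  define f where "f t = root n (max 0 t)" for t :: real
  have cf: "continuous_on S f" and cg: "continuous_on S (\<lambda>t. f (- t))" for S
    unfolding f_def by (intro continuous_intros)+
  have fn: "f t ^ n = max 0 t" for t
    unfolding f_def using n by (intro real_root_pow_pos2) auto
  have f0: "f t * f (- t) = 0" "f (- t) * f t = 0" for t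
    unfolding f_def using n by (auto simp: max_def)
  define a where "a = cfc x f"
  define b where "b = cfc x (\<lambda>t. f (- t))"
  have sab: "star a = a" "star b = b"
    unfolding a_def b_def by (intro star_cfc[OF sa] cf cg)+
  have ab: "a * b = 0" "b * a = 0"
    unfolding a_def b_def cfc_mult[OF sa cf cg, symmetric] cfc_mult[OF sa cg cf, symmetric] f0
    by (simp_all add: cfc_const[OF sa])
  define w where "w = cis (pi / real n)"
  have w: "w ^ n = -1" "cnj w * w = 1" "w * cnj w = 1"
    using n by (simp_all add: w_def Complex.DeMoivre cis_cnj cis_mult)
  define y where "y = a + w *\<^sub>C b"
  show thesis
  proof (rule that)
    show "normal_element y"
      unfolding normal_element_def y_def
      by (simp add: star_add star_scaleC sab algebra_simps mult_scaleC_left mult_scaleC_right scaleC_scaleC ab w)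
    have "y ^ n = a ^ n - b ^ n"
      unfolding y_def using ab n
      by (subst orthogonal_power_add)
        (simp_all add: mult_scaleC_left mult_scaleC_right power_scaleC w scaleC_minus1)
    also have "a ^ n = cfc x (max 0)"
      by (simp add: a_def fn flip: cfc_power[OF sa cf])
    also have "b ^ n = cfc x (\<lambda>t. max 0 (- t))"
      by (simp add: b_def fn flip: cfc_power[OF sa cg])
    also have "cfc x (max 0) - cfc x (\<lambda>t. max 0 (- t)) = cfc x (\<lambda>t. max 0 t - max 0 (- t))"
      by (rule cfc_diff[OF sa, symmetric]) (intro continuous_intros)+
    also have "(\<lambda>t. max 0 t - max 0 (- t)) = (\<lambda>t::real. t)" by (auto simp: fun_eq_iff max_def)
    finally show "y ^ n = x" by (simp add: cfc_ident[OF sa])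
  qed
qed

lemma power_one_add_expansion:
  fixes w :: "'a::real_normed_algebra_1"
  shows "\<exists>K\<ge>0. \<forall>t. \<bar>t\<bar> \<le> 1 \<longrightarrow> norm ((1 + t *\<^sub>R w) ^ n - 1 - (real n * t) *\<^sub>R w) \<le> K * t\<^sup>2"
proof (induction n)
  case 0
  then show ?case by (intro exI[of _ 0]) simp
next
  case (Suc n)
  then obtain K where K: "K \<ge> 0"
    "\<And>t. \<bar>t\<bar> \<le> 1 \<Longrightarrow> norm ((1 + t *\<^sub>R w) ^ n - 1 - (real n * t) *\<^sub>R w) \<le> K * t\<^sup>2" by blast
  have "norm ((1 + t *\<^sub>R w) ^ Suc n - 1 - (real (Suc n) * t) *\<^sub>R w) \<le>
      ((1 + norm w) * K + real n * norm (w * w)) * t\<^sup>2" if t: "\<bar>t\<bar> \<le> 1" for t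
  proof -
    define q where "q = (1 + t *\<^sub>R w) ^ n - 1 - (real n * t) *\<^sub>R w"
    have p: "(1 + t *\<^sub>R w) ^ n = q + 1 + (real n * t) *\<^sub>R w" by (simp add: q_def)
    have q: "norm q \<le> K * t\<^sup>2" unfolding q_def by (rule K(2)[OF t])
    have "(1 + t *\<^sub>R w) ^ Suc n - 1 - (real (Suc n) * t) *\<^sub>R w =
        (1 + t *\<^sub>R w) * q + (real n * t\<^sup>2) *\<^sub>R (w * w)"
      unfolding power_Suc p by (simp add: algebra_simps power2_eq_square)
    also have "norm \<dots> \<le> (1 + norm w) * (K * t\<^sup>2) + real n * t\<^sup>2 * norm (w * w)"
    proof (rule norm_triangle_mono)
      have "norm (1 + t *\<^sub>R w) \<le> 1 + \<bar>t\<bar> * norm w"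
        using norm_triangle_ineq[of 1 "t *\<^sub>R w"] by simp
      also have "\<dots> \<le> 1 + 1 * norm w" using t by (intro add_left_mono mult_right_mono) auto
      finally have "norm (1 + t *\<^sub>R w) * norm q \<le> (1 + norm w) * (K * t\<^sup>2)"
        using q K(1) by (intro mult_mono) auto
      then show "norm ((1 + t *\<^sub>R w) * q) \<le> (1 + norm w) * (K * t\<^sup>2)"
        by (rule order_trans[OF norm_mult_ineq])
    qed simp
    finally show ?thesis by (simp add: algebra_simps)
  qed
  then show ?case using K(1) by (intro exI[of _ "(1 + norm w) * K + real n * norm (w * w)"]) auto
qed

text \<open>Used with \<open>s\<close> the square of \<open>t\<close>, to keep a bound of the form
  \<open>1 + K s\<close> when passing to \<open>n\<close>-th powers.\<close>

lemma real_power_one_add_le: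
  fixes a s :: real
  assumes "0 \<le> a" "0 \<le> s" "s \<le> 1"
  shows "(1 + a * s) ^ n \<le> 1 + (1 + a) ^ n * s"
proof (induction n)
  case (Suc n)
  have "(1 + a * s) ^ Suc n = (1 + a * s) ^ n + a * s * (1 + a * s) ^ n" by (simp add: algebra_simps)
  also have "\<dots> \<le> (1 + (1 + a) ^ n * s) + a * s * (1 + a) ^ n"
    using assms by (intro add_mono Suc mult_left_mono power_mono) (auto intro: mult_left_le)
  finally show ?case by (simp add: algebra_simps)
qed (use assms in simp)

text \<open>The square identity at \<open>a + a ^ k\<close> is polarized; since \<open>a\<close>
  commutes with its powers, the anticommutator is twice the product.\<close>

lemma jordan_power:
  fixes S :: "'a::unital_cstar_algebra \<Rightarrow> 'b::unital_cstar_algebra"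
  assumes lin: "linear S" and one: "S 1 = 1" and sq: "\<And>a. S (a * a) = S a * S a"
  shows "S (a ^ k) = S a ^ k"
proof (induction k)
  case (Suc k)
  have "S ((a + a ^ k) * (a + a ^ k)) = (S a + S a ^ k) * (S a + S a ^ k)"
    by (simp add: sq linear_add[OF lin] Suc)
  moreover have "(a + a ^ k) * (a + a ^ k) = a * a + a ^ k * a ^ k + 2 *\<^sub>R a ^ Suc k"
    by (simp add: algebra_simps power_commutes scaleR_2)
  moreover have "(S a + S a ^ k) * (S a + S a ^ k) = S a * S a + S a ^ k * S a ^ k + 2 *\<^sub>R S a ^ Suc k"
    by (simp add: algebra_simps power_commutes scaleR_2)
  ultimately have "2 *\<^sub>R S (a ^ Suc k) = 2 *\<^sub>R S a ^ Suc k"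
    using sq[of "a ^ k"] by (simp add: linear_add[OF lin] linear_scale[OF lin] sq Suc)
  then show ?case by simp
qed (simp add: one)

lemma jordan_if_power_isometry:
  fixes S :: "'a::unital_cstar_algebra \<Rightarrow> 'b::unital_cstar_algebra"
  assumes clin: "clinear S" and one: "S 1 = 1" and surj: "surj S" and n: "n \<ge> 1"
    and iso: "\<And>y. normal_element y \<Longrightarrow> norm (S (y ^ n)) = norm y ^ n"
  shows "jordan_star_isomorphism S"
proof -
  have lin: "linear S" by (rule clinear_imp_linear[OF clin])
  have S_scaleC: "S (c *\<^sub>C a) = c *\<^sub>C S a" for c a by (rule clinear_scaleC[OF clin])
  note S_simps = linear_add[OF lin] linear_diff[OF lin] linear_scale[OF lin] S_scaleC one
  have isom: "norm (S x) = norm x" if sa: "star x = x" for x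
  proof -
    obtain y where y: "normal_element y" "y ^ n = x" using selfadjoint_normal_root[OF sa n] .
    then show ?thesis using iso[OF y(1)] norm_power_normal[OF y(1), of n] by simp
  qed
  \<comment> \<open>The two cartesian parts cost the factor 2. The bound serves for the remainder
    \<open>q\<close> below, which need not be self-adjoint.\<close>
  have S_bound: "norm (S a) \<le> 2 * norm a" for a
  proof -
    obtain x y where xy: "star x = x" "star y = y" "a = x + \<i> *\<^sub>C y" "norm x \<le> norm a" "norm y \<le> norm a"
      using cartesian_decomposition .
    have "norm (S a) \<le> norm (S x) + norm (S y)"
      using norm_triangle_ineq[of "S x" "\<i> *\<^sub>C S y"] by (simp add: xy(3) S_simps norm_scaleC)
    then show ?thesis using isom[OF xy(1)] isom[OF xy(2)] xy(4,5) by simp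
  qed
  have S_sa: "star (S x) = S x" if sa: "star x = x" for x
  proof -
    define w where "w = (1 / real n) *\<^sub>R (\<i> *\<^sub>C x)"
    have sw: "star w = - w" by (simp add: w_def star_scaleR star_scaleC sa complex_vector.scale_minus_left)
    obtain K where K: "K \<ge> 0"
      "\<And>t. \<bar>t\<bar> \<le> 1 \<Longrightarrow> norm ((1 + t *\<^sub>R w) ^ n - 1 - (real n * t) *\<^sub>R w) \<le> K * t\<^sup>2"
      using power_one_add_expansion[of w n] by blast
    define A where "A = norm (w * w)"
    show ?thesis
    proof (rule selfadjoint_if_norm_flat)
      show "0 \<le> (1 + A) ^ n + 2 * K" using K(1) by (simp add: A_def)
      fix t :: real assume t: "\<bar>t\<bar> \<le> 1"
      define y where "y = 1 + t *\<^sub>R w"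
      have y1: "star y = 1 - t *\<^sub>R w" by (simp add: y_def star_add star_scaleR sw)
      have t2: "t\<^sup>2 \<le> 1" using t by (simp add: abs_square_le_1)
      \<comment> \<open>As \<open>w\<close> is skew-adjoint, the first-order terms of
        \<open>star y * y\<close> cancel, and \<open>norm y\<close> exceeds 1 only to second
        order.\<close>
      have "(norm y)\<^sup>2 = norm (1 - t\<^sup>2 *\<^sub>R (w * w))"
        unfolding cstar_identity[symmetric] y1 by (simp add: y_def algebra_simps power2_eq_square)
      also have "\<dots> \<le> 1 + A * t\<^sup>2"
        using norm_triangle_ineq4[of 1 "t\<^sup>2 *\<^sub>R (w * w)"] by (simp add: A_def mult.commute)
      also have "\<dots> \<le> (1 + A * t\<^sup>2)\<^sup>2"
        by (rule self_le_power) (auto simp: A_def)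
      finally have "norm y \<le> 1 + A * t\<^sup>2"
        by (rule power2_le_imp_le) (simp add: A_def)
      then have "norm y ^ n \<le> (1 + A * t\<^sup>2) ^ n" by (intro power_mono) auto
      also have "\<dots> \<le> 1 + (1 + A) ^ n * t\<^sup>2"
        by (rule real_power_one_add_le) (use t2 in \<open>auto simp: A_def\<close>)
      finally have ny: "norm y ^ n \<le> 1 + (1 + A) ^ n * t\<^sup>2" .
      have normal: "normal_element y"
        unfolding normal_element_def y1 by (simp add: y_def algebra_simps)
      define q where "q = y ^ n - 1 - (real n * t) *\<^sub>R w"
      have q: "norm q \<le> K * t\<^sup>2" unfolding q_def y_def by (rule K(2)[OF t])
      have "1 + (real n * t) *\<^sub>R w = y ^ n - q" by (simp add: q_def)
      moreover have "(real n * t) *\<^sub>R w = t *\<^sub>R (\<i> *\<^sub>C x)" using n by (simp add: w_def)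
      ultimately have "S (1 + t *\<^sub>R (\<i> *\<^sub>C x)) = S (y ^ n) - S q" by (simp add: S_simps)
      then have "1 + t *\<^sub>R (\<i> *\<^sub>C S x) = S (y ^ n) - S q" by (simp add: S_simps)
      also have "norm \<dots> \<le> norm y ^ n + 2 * norm q"
        using norm_triangle_ineq4[of "S (y ^ n)" "S q"] iso[OF normal] S_bound[of q] by simp
      also have "\<dots> \<le> 1 + ((1 + A) ^ n + 2 * K) * t\<^sup>2"
        using ny q by (simp add: algebra_simps)
      finally show "norm (1 + t *\<^sub>R (\<i> *\<^sub>C S x)) \<le> 1 + ((1 + A) ^ n + 2 * K) * t\<^sup>2" .
    qed
  qed
  have S_star: "S (star a) = star (S a)" for a
  proof -
    obtain x y where xy: "star x = x" "star y = y" "a = x + \<i> *\<^sub>C y"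
      using cartesian_decomposition by metis
    have "star a = x - \<i> *\<^sub>C y"
      by (simp add: xy star_add star_scaleC complex_vector.scale_minus_left)
    then show ?thesis
      by (simp add: xy(3) S_simps star_add star_scaleC S_sa xy(1,2) complex_vector.scale_minus_left)
  qed
  \<comment> \<open>Taking adjoints separates \<open>S x = 0\<close> from \<open>S y = 0\<close>,
    where the isometry on self-adjoint elements applies.\<close>
  have inj0: "a = 0" if "S a = 0" for a
  proof -
    obtain x y where xy: "star x = x" "star y = y" "a = x + \<i> *\<^sub>C y"
      using cartesian_decomposition by metis
    have sx: "S x + \<i> *\<^sub>C S y = 0" using that by (simp add: xy(3) S_simps)
    have "S x - \<i> *\<^sub>C S y = star (S x + \<i> *\<^sub>C S y)"
      by (simp add: star_add star_scaleC S_sa xy complex_vector.scale_minus_left)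
    then have dx: "S x - \<i> *\<^sub>C S y = 0" using sx by simp
    have "2 *\<^sub>R S x = (S x + \<i> *\<^sub>C S y) + (S x - \<i> *\<^sub>C S y)" by (simp add: scaleR_2)
    then have "S x = 0" using sx dx by simp
    moreover from this have "S y = 0" using sx by simp
    ultimately show ?thesis using isom[OF xy(1)] isom[OF xy(2)] by (simp add: xy(3))
  qed
  have inj: "inj S"
  proof (rule injI)
    show "a = b" if "S a = S b" for a b using inj0[of "a - b"] that by (simp add: S_simps)
  qed
  define R where "R = inv S"
  have SR: "S (R b) = b" for b unfolding R_def by (rule surj_f_inv_f[OF surj])
  have RS: "R (S a) = a" for a unfolding R_def by (rule inv_f_f[OF inj])
  have lin_R: "linear R"
  proof (rule linearI)
    show "R (a + b) = R a + R b" for a b using RS[of "R a + R b"] by (simp add: S_simps SR)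
    show "R (c *\<^sub>R a) = c *\<^sub>R R a" for c a using RS[of "c *\<^sub>R R a"] by (simp add: S_simps SR)
  qed
  have R_star: "R (star b) = star (R b)" for b
    using RS[of "star (R b)"] by (simp add: S_star SR)
  have S_pos: "nonneg_element (S p)" if p: "nonneg_element p" for p
  proof -
    obtain r where r: "norm (r *\<^sub>R 1 - p) \<le> r" and sp: "star p = p"
      using p by (auto simp: nonneg_element_def)
    have "norm (r *\<^sub>R 1 - S p) = norm (S (r *\<^sub>R 1 - p))" by (simp add: S_simps)
    also have "\<dots> = norm (r *\<^sub>R 1 - p)" by (rule isom) (simp add: star_diff star_scaleR sp)
    finally show ?thesis using r S_sa[OF sp]
      by (auto simp: nonneg_element_def intro!: exI[of _ r])
  qed
  have sq_sa: "S (x * x) = S x * S x" if sa: "star x = x" for x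
  proof -
    have "nonneg_element (S (x * x) - S x * S x)"
      by (rule Kadison_inequality[OF lin one S_sa]) (simp_all add: isom sa)
    \<comment> \<open>Kadison's inequality for the inverse at \<open>S x\<close>; applying the
      positive map \<open>S\<close> to it gives the reverse inequality for \<open>S\<close>.\<close>
    moreover have "nonneg_element (R (S x * S x) - R (S x) * R (S x))"
    proof (rule Kadison_inequality[OF lin_R])
      show "R 1 = 1" using RS[of 1] one by simp
      show "star (R b) = R b" if "star b = b" for b using R_star[of b] that by simp
      show "norm (R b) \<le> norm b" if "star b = b" for b
        using isom[of "R b"] R_star[of b] that by (simp add: SR)
    qed (rule S_sa[OF sa])
    then have "nonneg_element (S (R (S x * S x) - x * x))" by (intro S_pos) (simp add: RS)
    then have "nonneg_element (- (S (x * x) - S x * S x))" by (simp add: S_simps SR)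
    ultimately have "S (x * x) - S x * S x = 0" by (rule nonneg_element_antisym)
    then show ?thesis by simp
  qed
  have "S (a * a) = S a * S a" for a
  proof -
    obtain x y where xy: "star x = x" "star y = y" "a = x + \<i> *\<^sub>C y"
      using cartesian_decomposition by metis
    \<comment> \<open>The self-adjoint case at \<open>x + y\<close> yields the anticommutator, which
      is the cross term in the square of \<open>x + i y\<close>.\<close>
    have "star (x + y) = x + y" by (simp add: star_add xy)
    from sq_sa[OF this] have anti: "S (x * y) + S (y * x) = S x * S y + S y * S x"
      using sq_sa[OF xy(1)] sq_sa[OF xy(2)] by (simp add: S_simps algebra_simps)
    have expand: "(u + \<i> *\<^sub>C v) * (u + \<i> *\<^sub>C v) = u * u - v * v + \<i> *\<^sub>C (u * v + v * u)"
      for u v :: "'c::unital_cstar_algebra"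
      by (simp add: algebra_simps mult_scaleC_left mult_scaleC_right scaleC_scaleC scaleC_minus1 scaleC_add_right)
    show ?thesis
      by (simp add: xy(3) expand S_simps anti sq_sa[OF xy(1)] sq_sa[OF xy(2)])
  qed
  then show ?thesis
    unfolding jordan_star_isomorphism_def using inj surj clin S_star
    by (auto simp: bij_def power2_eq_square)
qed

section \<open>From the polynomial to the Jordan isomorphism\<close>

text \<open>Lists with the same multiset differ by a permutation, so symmetry makes the list picked
  by \<open>SOME\<close> immaterial.\<close>

lemma symmetric_form_exists:
  fixes L :: "'a::complex_vector list \<Rightarrow> 'b::complex_vector"
  assumes ml: "multilinear n L" and sym: "symmetric_map n L"
  obtains M where "symmetric_form n M" "\<And>xs. length xs = n \<Longrightarrow> M (mset xs) = L xs"
proof -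
  define M where "M X = L (SOME xs. mset xs = X)" for X
  have M: "M (mset xs) = L xs" if len: "length xs = n" for xs
  proof -
    define ys where "ys = (SOME ys. mset ys = mset xs)"
    have "mset ys = mset xs" unfolding ys_def by (rule someI) (rule refl)
    then obtain p where "p permutes {..<length xs}" "permute_list p xs = ys"
      using mset_eq_permutation by metis
    then show ?thesis using sym len unfolding M_def ys_def[symmetric] symmetric_map_def by metis
  qed
  have cons: "M (add_mset a (mset xs)) = L (a # xs)" if "length xs + 1 = n" for a xs
    using M[of "a # xs"] that by simp
  have lin: "clinear (\<lambda>y. L (y # xs))" if "length xs + 1 = n" for xs
    \<comment> \<open>The head \<open>undefined\<close> is a dummy that the update at position 0
      overwrites.\<close>
    using ml[unfolded multilinear_def, rule_format, of "undefined # xs" 0] that by simp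
  have "symmetric_form n M"
  proof
    fix X :: "'a multiset" and a b :: 'a and c :: complex
    assume X: "size X + 1 = n"
    obtain xs where xs: "mset xs = X" using ex_mset by blast
    then have len: "length xs + 1 = n" using X by auto
    show "M (add_mset (a + b) X) = M (add_mset a X) + M (add_mset b X)"
      using clinear_add[OF lin[OF len]] by (simp add: cons[OF len] flip: xs)
    show "M (add_mset (c *\<^sub>C a) X) = c *\<^sub>C M (add_mset a X)"
      using clinear_scaleC[OF lin[OF len]] by (simp add: cons[OF len] flip: xs)
  qed
  then show thesis using M that by blast
qed

theorem theorem4p3:
  fixes P :: "'a::unital_cstar_algebra \<Rightarrow> 'b::unital_cstar_algebra"
    and n :: nat and h :: 'b
  assumes "n \<ge> 1"
    and "homogeneous_polynomial n P"
    and "orthogonally_additive P"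
    and "h = P 1"
    and "unitary h"
    and "complex_vector.span (range P) = UNIV"
    and "\<And>x. normal_element x \<Longrightarrow> norm (P x) = norm x ^ n"
  shows "\<exists>J :: 'a \<Rightarrow> 'b. jordan_star_isomorphism J \<and> (\<forall>a. P a = h * J a ^ n)"
proof -
  obtain L where L: "multilinear n L" "symmetric_map n L" "\<And>x. P x = L (replicate n x)"
    using assms(2) unfolding homogeneous_polynomial_def by blast
  obtain M where M: "symmetric_form n M" "\<And>xs. length xs = n \<Longrightarrow> M (mset xs) = L xs"
    using symmetric_form_exists[OF L(1,2)] by blast
  have P: "P x = M (replicate_mset n x)" for x
    using M(2)[of "replicate n x"] by (simp add: L(3))
  interpret orthogonally_additive_form n M
  proof (intro orthogonally_additive_form.intro M(1) orthogonally_additive_form_axioms.intro)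
    show "norm (M (replicate_mset n a)) \<le> norm a ^ n" if "star a = a" for a
      using assms(7)[of a] that by (simp add: P normal_element_def)
    show "M (replicate_mset n (a + b)) = M (replicate_mset n a) + M (replicate_mset n b)"
      if "a * b = 0" "b * a = 0" for a b
      using assms(3) that by (simp add: orthogonally_additive_def P)
  qed
  define T where "T a = M (add_mset a (replicate_mset (n - 1) 1))" for a
  have sz: "size (replicate_mset (n - 1) (1::'a)) + 1 = n" using assms(1) by simp
  have PT: "P a = T (a ^ n)" for a
    unfolding P T_def by (rule replicate_eq_power[OF assms(1)])
  have hh: "star h * h = 1" "h * star h = 1" using assms(5) by (auto simp: unitary_def)
  define J where "J a = star h * T a" for a
  have T: "T a = h * J a" for a
    by (simp add: J_def hh flip: mult.assoc)
  have J_clinear: "clinear J"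
    by (rule clinearI) (simp_all only: J_def T_def add[OF sz] scaleC[OF sz] distrib_left mult_scaleC_right)
  have one: "J 1 = 1" using PT[of 1] assms(4) hh by (simp add: J_def)
  have "surj J"
  proof -
    have "P a \<in> range T" for a using PT by auto
    moreover have "complex_vector.subspace (range T)"
    proof -
      have T_add: "T (u + v) = T u + T v" and T_scaleC: "T (c *\<^sub>C u) = c *\<^sub>C T u" for c u v
        by (simp_all only: T_def add[OF sz] scaleC[OF sz])
      have "0 = T 0" using T_scaleC[of 0 0] by simp
      then have "0 \<in> range T" by (rule range_eqI)
      then show ?thesis
        by (intro complex_vector.subspaceI) (auto simp flip: T_add T_scaleC)
    qed
    ultimately have "complex_vector.span (range P) \<subseteq> range T"
      by (intro complex_vector.span_minimal) auto
    \<comment> \<open>Taking \<open>h * b\<close> instead of \<open>b\<close> cancels the factor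
      \<open>star h\<close> in \<open>J\<close>.\<close>
    then have "\<exists>a. h * b = T a" for b using assms(6) by auto
    then have "\<exists>a. b = J a" for b
      using J_def hh by (metis mult.assoc mult_1)
    then show ?thesis unfolding surj_def by blast
  qed
  moreover have "norm (J (y ^ n)) = norm y ^ n" if "normal_element y" for y
    using assms(7)[OF that] norm_unitary_mult[of "star h" "P y"] by (simp add: J_def PT star_star hh)
  ultimately have jordan: "jordan_star_isomorphism J"
    by (intro jordan_if_power_isometry[OF J_clinear one _ assms(1)])
  have "P a = h * J a ^ n" for a
  proof -
    have "J (a ^ n) = J a ^ n"
      by (rule jordan_power[OF clinear_imp_linear[OF J_clinear] one])
        (use jordan in \<open>simp add: jordan_star_isomorphism_def power2_eq_square\<close>)
    then show ?thesis by (simp add: PT T)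
  qed
  with jordan show ?thesis by blast
qed

end
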